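(* Consider the elliptic boundary value problem described in the context, possibly with both absorbing ($\partial\Omega_A$) and reflecting ($\partial\Omega_R$) boundary parts, and a PDDSparse discretisation of it into $N$ knots $\mathbf{x}_1,\dots,\mathbf{x}_N$, none of which lies at a point where $\partial\Omega_A$ and $\partial\Omega_R$ meet (i.e. in $\overline{\partial\Omega_A}\cap\overline{\partial\Omega_R}$; such a meeting point would lie in the middle of a perimeter patch). Let $G$ be the PDDSparse matrix. Then $$\|G^{-1}\|_\infty\;\le\;1+\frac{\max_{\mathbf{x}_i\in\Omega}\mathbb{E}[\tau_i^{\Omega}]}{\min_{\mathbf{x}_j\in\overline{\Omega}\setminus\partial\Omega_A}\mathbb{E}[\tau_j^{\#}]},$$ where $\tau_i^\Omega:=\tau^\Omega(\mathbf{x}_i)$, the maximum is over the knots $\mathbf{x}_i$ lying in $\Omega$, and the minimum is over the knots $\mathbf{x}_j$ not lying on $\partial\Omega_A$.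
   Context: Boundary value problem. $\Omega\subset\mathbb{R}^2$ is bounded, open, connected, $\partial\Omega=\partial\Omega_A\cup\partial\Omega_R$ disjointly, $\partial\Omega_A\neq\emptyset$. $\mathcal{L}u=\frac12\sum a_{ij}\partial_i\partial_j u+\sum_k b_k\partial_k u$ with $[a_{ij}]=\sigma\sigma^\top$ positive definite. The problem is $\mathcal{L}u+cu+f=0$ in $\Omega$, $u=g$ on $\partial\Omega_A$, $\mathbf{N}^\top\nabla u=\varphi u+\psi$ on $\partial\Omega_R$ ($\mathbf{N}$ outward normal), with $c,\varphi\le0$. Coefficients and boundary are regular enough that such problems (on $\Omega$ and on the patches below) have unique smooth solutions given by the Feynman-Kac formula, and expected exit times are finite. Diffusion. $d\mathbf{X}_t=\mathbf{b}(\mathbf{X}_t)dt+\sigma(\mathbf{X}_t)d\mathbf{W}_t-\mathbf{N}(\mathbf{X}_t)d\xi_t$ is the diffusion with generator $\mathcal{L}$, normally reflected on $\partial\Omega_R$ (with local time $\xi$); $dY_t=c(\mathbf{X}_t)Y_t\,dt+\varphi(\mathbf{X}_t)Y_t\,d\xi_t$, $Y_0=1$, so $0<Y_t\le1$. $\tau^\Omega(\mathbf{x})$ is the first hitting time of $\partial\Omega_A$ when $\mathbf{X}_0=\mathbf{x}$. Its expectation solves $\mathcal{L}v+1=0$ in $\Omega$, $v=0$ on $\partial\Omega_A$, $\mathbf{N}^\top\nabla v=0$ on $\partial\Omega_R$. Discretisation. $\Omega$ is partitioned by a grid of equal squares into nonoverlapping subdomains (squares intersected with $\Omega$). The fictitious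 boundaries between side-adjacent subdomains (interfaces) carry finitely many knots $\mathbf{x}_1,\dots,\mathbf{x}_N$, including knots at grid crossings in $\Omega$ and where the interfaces meet $\partial\Omega$. The patch $\Pi(\mathbf{x}_i)$ is the union of all subdomains to which $\mathbf{x}_i$ belongs (a perimeter patch if it contains a subdomain whose square is not fully immersed in $\Omega$); the part of its boundary not on $\partial\Omega$ is split into at most four sides $\partial^O\Pi(\mathbf{x}_i)$, $O\in\{E,N,W,S\}$ (some possibly empty). Each nonempty side has a stencil $\mathcal{S}_i^O$: the knots on that side, possibly together with further collinear knots beyond its ends; $\mathbf{x}_i\notin\mathcal{S}_i^O$. $H_{ij}^O$ ($\mathbf{x}_j\in\mathcal{S}_i^O$) are the cardinal interpolation functions of the stencil on that side. For the diffusion started at $\mathbf{x}_i$, $\tau_i^{\#}$ is the first time it exits $\Pi(\mathbf{x}_i)$ through its sides $\partial^O\Pi(\mathbf{x}_i)$ or hits $\partial\Omega_A$ (it is reflected on $\partial\Omega_R$). Matrix. If $\mathbf{x}_i\in\partial\Omega_A$, then $G_{ij}=\delta_{ij}$. Otherwise $G_{ii}=1$ and, for $j\ne i$, $$G_{ij}=-\sum_{O:\ \mathbf{x}_j\in\mathcal{S}_i^O}\mathbb{E}\big[Y_{\tau_i^\#}\mathbb{1}_{\{\mathbf{X}_{\tau_i^\#}\in\partial^O\Pi(\mathbf{x}_i)\}}H_{ij}^O(\mathbf{X}_{\tau_i^\#})\,\big|\,\mathbf{X}_0=\mathbf{x}_i\big]$$ (zero if $\mathbf{x}_j$ is in no stencil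 of $\mathbf{x}_i$). Standing assumptions. (a) $G$ is an invertible M-matrix, i.e. $G=I-B$ with $B\ge0$ entrywise and spectral radius $\rho(B)<1$ (so $G^{-1}\ge0$ entrywise). (b) Interpolation errors are neglected: for the functions $u=\alpha+\beta\,\mathbb{E}[\tau^\Omega(\cdot)]$ with $\alpha,\beta\in\mathbb{R}$ one has $u(\mathbf{x})=\sum_{\mathbf{x}_j\in\mathcal{S}_i^O}u(\mathbf{x}_j)H_{ij}^O(\mathbf{x})$ for $\mathbf{x}\in\partial^O\Pi(\mathbf{x}_i)$, all $i$ and $O$.
   Formalization: As stated the bound can fail with knots on ∂Ω_R; proved with the maximum over all knots not on ∂Ω_A, and with the maximum over knots in Ω if each knot on ∂Ω_R has E[τ^Ω] at most that of some knot in Ω or all stencil knots lie in Ω. Some knot is assumed to lie in Ω. *)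

theory Defs
  imports "HOL-Probability.Probability"
begin

type_synonym point = "real^2"


section \<open>The boundary value problem\<close>

text \<open>
  The problem is L u + c u + f = 0 in the region, u = g on the absorbing part of the boundary and
  N . grad u = phi u + psi on the reflecting part.  The type variable \<^typ>\<open>'d\<close> is the dimension of
  the driving Brownian motion, i.e. sigma is a 2 x d matrix.
\<close>

record 'd bvp =
  region :: "point set"
  absorbing :: "point set"
  reflecting :: "point set"
  outer_normal :: "point \<Rightarrow> point"
  sigma_coeff :: "point \<Rightarrow> real^'d^2"
  drift_coeff :: "point \<Rightarrow> point"
  c_coeff :: "point \<Rightarrow> real"
  f_data :: "point \<Rightarrow> real"
  g_data :: "point \<Rightarrow> real"
  phi_coeff :: "point \<Rightarrow> real"
  psi_data :: "point \<Rightarrow> real"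

definition a_coeff :: "'d::finite bvp \<Rightarrow> point \<Rightarrow> real^2^2" where
  "a_coeff B x = sigma_coeff B x ** transpose (sigma_coeff B x)"

text \<open>The boundary is differentiable at \<open>x\<close> with outward unit normal \<open>n\<close>: up to o(|y - x|), the set
  is the half-space below its tangent line.\<close>

definition outward_unit_normal :: "point set \<Rightarrow> point \<Rightarrow> point \<Rightarrow> bool" where
  "outward_unit_normal D x n \<longleftrightarrow> norm n = 1 \<and>
     (\<forall>\<epsilon>>0. \<exists>\<delta>>0. \<forall>y\<in>ball x \<delta>.
        (y \<in> D \<longrightarrow> n \<bullet> (y - x) \<le> \<epsilon> * norm (y - x)) \<and>
        (y \<notin> D \<longrightarrow> - \<epsilon> * norm (y - x) \<le> n \<bullet> (y - x)))"

text \<open>Measurability fixes nothing but the irrelevant values off the respective part of the boundary,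
  which the path visits with probability 0 or during a null set of the local time.\<close>

definition admissible_data :: "'d::finite bvp \<Rightarrow> bool" where
  "admissible_data B \<longleftrightarrow>
     continuous_on (closure (region B)) (c_coeff B) \<and>
     continuous_on (closure (region B)) (f_data B) \<and>
     continuous_on (absorbing B) (g_data B) \<and>
     continuous_on (closure (reflecting B)) (phi_coeff B) \<and>
     continuous_on (closure (reflecting B)) (psi_data B) \<and>
     g_data B \<in> borel_measurable borel \<and>
     phi_coeff B \<in> borel_measurable borel \<and>
     psi_data B \<in> borel_measurable borel \<and>
     (\<forall>x\<in>closure (region B). c_coeff B x \<le> 0) \<and>
     (\<forall>x\<in>closure (reflecting B). phi_coeff B x \<le> 0)"

text \<open>No smoothness of the boundary is asked for where the two parts of the boundary meet.\<close>

definition elliptic_bvp :: "'d::finite bvp \<Rightarrow> bool" where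
  "elliptic_bvp B \<longleftrightarrow>
     open (region B) \<and> bounded (region B) \<and> connected (region B) \<and>
     absorbing B \<union> reflecting B = frontier (region B) \<and>
     absorbing B \<inter> reflecting B = {} \<and> absorbing B \<noteq> {} \<and>
     (\<forall>x\<in>reflecting B - closure (absorbing B). outward_unit_normal (region B) x (outer_normal B x)) \<and>
     continuous_on (reflecting B - closure (absorbing B)) (outer_normal B) \<and>
     continuous_on (closure (region B)) (sigma_coeff B) \<and>
     continuous_on (closure (region B)) (drift_coeff B) \<and>
     (\<forall>x\<in>closure (region B). \<forall>y. y \<noteq> 0 \<longrightarrow> 0 < y \<bullet> (a_coeff B x *v y)) \<and>
     admissible_data B"

text \<open>The points at which solutions are twice continuously differentiable (up to the boundary).\<close>

definition smooth_points :: "'d::finite bvp \<Rightarrow> point set" where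
  "smooth_points B = region B \<union> (reflecting B - closure (absorbing B))"

text \<open>Classical solutions; \<open>p\<close> is the gradient and \<open>H\<close> the Hessian of \<open>u\<close>.\<close>

definition solves :: "'d::finite bvp \<Rightarrow> (point \<Rightarrow> real) \<Rightarrow> bool" where
  "solves B u \<longleftrightarrow> continuous_on (closure (region B)) u \<and>
     (\<exists>(p :: point \<Rightarrow> point) (H :: point \<Rightarrow> real^2^2).
        (\<forall>x\<in>smooth_points B. (u has_derivative (\<lambda>h. p x \<bullet> h)) (at x within smooth_points B)) \<and>
        (\<forall>x\<in>smooth_points B. (p has_derivative (\<lambda>h. H x *v h)) (at x within smooth_points B)) \<and>
        continuous_on (smooth_points B) H \<and>
        (\<forall>x\<in>region B.
           (1/2) * (\<Sum>i\<in>UNIV. \<Sum>j\<in>UNIV. a_coeff B x $ i $ j * H x $ i $ j)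
           + (\<Sum>k\<in>UNIV. drift_coeff B x $ k * p x $ k) + c_coeff B x * u x + f_data B x = 0) \<and>
        (\<forall>x\<in>absorbing B \<inter> closure (region B). u x = g_data B x) \<and>
        (\<forall>x\<in>reflecting B - closure (absorbing B).
           outer_normal B x \<bullet> p x = phi_coeff B x * u x + psi_data B x))"

text \<open>The problem solved by the expected hitting time of the absorbing boundary.\<close>

definition exit_time_bvp :: "'d::finite bvp \<Rightarrow> 'd bvp" where
  "exit_time_bvp B = B\<lparr>c_coeff := (\<lambda>_. 0), f_data := (\<lambda>_. 1), g_data := (\<lambda>_. 0),
                        phi_coeff := (\<lambda>_. 0), psi_data := (\<lambda>_. 0)\<rparr>"


section \<open>The reflected diffusion\<close>

text \<open>
  A family of probability laws \<open>law D x\<close> (the conditional law given that the diffusion starts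
  at \<open>x\<close>) carrying a filtration, a Brownian motion, the diffusion, its local time and the weight Y.
  The processes are the same functions under all laws, as they may be taken to be on path space.
\<close>

record ('w, 'd) diffusion =
  law :: "point \<Rightarrow> 'w measure"
  hist :: "real \<Rightarrow> 'w measure"
  bm :: "real \<Rightarrow> 'w \<Rightarrow> real^'d"
  pos :: "real \<Rightarrow> 'w \<Rightarrow> point"
  local_time :: "real \<Rightarrow> 'w \<Rightarrow> real"
  weight :: "real \<Rightarrow> 'w \<Rightarrow> real"

definition adapted_continuous ::
    "'w measure \<Rightarrow> (real \<Rightarrow> 'w measure) \<Rightarrow> (real \<Rightarrow> 'w \<Rightarrow> 'b::euclidean_space) \<Rightarrow> bool" where
  "adapted_continuous M F Z \<longleftrightarrow>
     (\<forall>t\<ge>0. Z t \<in> borel_measurable (F t)) \<and>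
     (\<forall>\<omega>\<in>space M. continuous_on {0..} (\<lambda>t. Z t \<omega>))"

definition brownian_motion ::
    "'w measure \<Rightarrow> (real \<Rightarrow> 'w measure) \<Rightarrow> (real \<Rightarrow> 'w \<Rightarrow> real^'d::finite) \<Rightarrow> bool" where
  "brownian_motion M F W \<longleftrightarrow>
     adapted_continuous M F W \<and> (AE \<omega> in M. W 0 \<omega> = 0) \<and>
     (\<forall>s t. 0 \<le> s \<and> s < t \<longrightarrow>
        distributed M lborel (\<lambda>\<omega>. W t \<omega> - W s \<omega>)
          (\<lambda>x. ennreal (\<Prod>k\<in>UNIV. normal_density 0 (sqrt (t - s)) (x $ k))) \<and>
        prob_space.indep_set M (sets (F s))
          {(\<lambda>\<omega>. W t \<omega> - W s \<omega>) -` A \<inter> space M | A. A \<in> sets borel})"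

text \<open>
  \<open>I\<close> is the Ito integral of the continuous adapted matrix process \<open>S\<close> against \<open>W\<close>: for continuous
  integrands it is the limit in probability of the left-point Riemann sums along dyadic partitions.
\<close>

definition ito_integral ::
    "'w measure \<Rightarrow> (real \<Rightarrow> 'w measure) \<Rightarrow> (real \<Rightarrow> 'w \<Rightarrow> real^'d::finite) \<Rightarrow>
     (real \<Rightarrow> 'w \<Rightarrow> real^'d^2) \<Rightarrow> (real \<Rightarrow> 'w \<Rightarrow> point) \<Rightarrow> bool" where
  "ito_integral M F W S I \<longleftrightarrow> adapted_continuous M F I \<and>
     (\<forall>t\<ge>0. \<forall>\<epsilon>>0.
        (\<lambda>n::nat. measure M {\<omega>\<in>space M. \<epsilon> <
            norm ((\<Sum>k<nat \<lceil>t * 2 ^ n\<rceil>. S (real k / 2 ^ n) \<omega> *v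
                     (W (min t (real (Suc k) / 2 ^ n)) \<omega> - W (real k / 2 ^ n) \<omega>)) - I t \<omega>)})
        \<longlonglongrightarrow> 0)"

text \<open>First hitting time of a set, infinite if the set is not hit.\<close>

definition hitting_time :: "('w, 'd::finite) diffusion \<Rightarrow> point set \<Rightarrow> 'w \<Rightarrow> ennreal" where
  "hitting_time D S \<omega> = (INF t\<in>{t. 0 \<le> t \<and> pos D t \<omega> \<in> S}. ennreal t)"

text \<open>The Lebesgue-Stieltjes measure of the local time on \<open>[0, \<infinity>)\<close>.\<close>

definition d_xi :: "('w, 'd::finite) diffusion \<Rightarrow> 'w \<Rightarrow> real measure" where
  "d_xi D \<omega> = interval_measure (\<lambda>t. local_time D (max 0 t) \<omega>)"

text \<open>dX = b dt + sigma dW - N d xi, X started at \<open>x\<close>, up to the hitting time of the absorbing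
  boundary.\<close>

definition reflected_diffusion :: "'d::finite bvp \<Rightarrow> ('w, 'd) diffusion \<Rightarrow> point \<Rightarrow> bool" where
  "reflected_diffusion B D x \<longleftrightarrow>
     prob_space (law D x) \<and> filtration (space (law D x)) (hist D) \<and>
     (\<forall>t. sets (hist D t) \<subseteq> sets (law D x)) \<and>
     brownian_motion (law D x) (hist D) (bm D) \<and>
     adapted_continuous (law D x) (hist D) (pos D) \<and>
     adapted_continuous (law D x) (hist D) (local_time D) \<and>
     (\<forall>\<omega>\<in>space (law D x). \<forall>t\<ge>0. pos D t \<omega> \<in> closure (region B)) \<and>
     (\<forall>\<omega>\<in>space (law D x). local_time D 0 \<omega> = 0 \<and> mono_on {0..} (\<lambda>t. local_time D t \<omega>)) \<and>
     (AE \<omega> in law D x. pos D 0 \<omega> = x) \<and>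
     (AE \<omega> in law D x. AE t in d_xi D \<omega>.
        0 \<le> t \<and> ennreal t < hitting_time D (absorbing B) \<omega> \<longrightarrow> pos D t \<omega> \<in> reflecting B) \<and>
     (\<exists>I. ito_integral (law D x) (hist D) (bm D) (\<lambda>t \<omega>. sigma_coeff B (pos D t \<omega>)) I \<and>
        (AE \<omega> in law D x. \<forall>t\<ge>0. ennreal t \<le> hitting_time D (absorbing B) \<omega> \<longrightarrow>
           set_integrable (d_xi D \<omega>) {0..t} (\<lambda>s. outer_normal B (pos D s \<omega>)) \<and>
           pos D t \<omega> = x + (LINT s:{0..t}|lborel. drift_coeff B (pos D s \<omega>)) + I t \<omega>
                         - (LINT s:{0..t}|d_xi D \<omega>. outer_normal B (pos D s \<omega>))))"

text \<open>dY = c(X) Y dt + phi(X) Y d xi with initial value 1, up to the hitting time of the absorbing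
  boundary.\<close>

definition weight_process ::
    "'d::finite bvp \<Rightarrow> ('w, 'd) diffusion \<Rightarrow> point \<Rightarrow> (real \<Rightarrow> 'w \<Rightarrow> real) \<Rightarrow> bool" where
  "weight_process B D x Y \<longleftrightarrow> adapted_continuous (law D x) (hist D) Y \<and>
     (AE \<omega> in law D x. \<forall>t\<ge>0. ennreal t \<le> hitting_time D (absorbing B) \<omega> \<longrightarrow>
        set_integrable lborel {0..t} (\<lambda>s. c_coeff B (pos D s \<omega>) * Y s \<omega>) \<and>
        set_integrable (d_xi D \<omega>) {0..t} (\<lambda>s. phi_coeff B (pos D s \<omega>) * Y s \<omega>) \<and>
        Y t \<omega> = 1 + (LINT s:{0..t}|lborel. c_coeff B (pos D s \<omega>) * Y s \<omega>)
                  + (LINT s:{0..t}|d_xi D \<omega>. phi_coeff B (pos D s \<omega>) * Y s \<omega>))"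

text \<open>The Feynman-Kac representation of \<open>u\<close> at \<open>x\<close>, with weight process \<open>Y\<close>.\<close>

definition feynman_kac_formula ::
    "'d::finite bvp \<Rightarrow> ('w, 'd) diffusion \<Rightarrow> (real \<Rightarrow> 'w \<Rightarrow> real) \<Rightarrow> (point \<Rightarrow> real) \<Rightarrow> point \<Rightarrow> bool"
  where
  "feynman_kac_formula B D Y u x \<longleftrightarrow>
     u x = (LINT \<omega>|law D x.
              (let T = enn2real (hitting_time D (absorbing B) \<omega>)
               in g_data B (pos D T \<omega>) * Y T \<omega>
                  + (LINT t:{0..T}|lborel. f_data B (pos D t \<omega>) * Y t \<omega>)
                  + (LINT t:{0..T}|d_xi D \<omega>. psi_data B (pos D t \<omega>) * Y t \<omega>)))"

text \<open>
  On the geometry of \<open>B\<close>, whatever the data, every classical solution is the one given by the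
  Feynman-Kac formula; in particular it is unique.
\<close>

definition feynman_kac_valid :: "'d::finite bvp \<Rightarrow> ('w, 'd) diffusion \<Rightarrow> bool" where
  "feynman_kac_valid B D \<longleftrightarrow>
     (\<forall>c f g \<phi> \<psi> Y u.
        let B' = B\<lparr>c_coeff := c, f_data := f, g_data := g, phi_coeff := \<phi>, psi_data := \<psi>\<rparr>
        in admissible_data B' \<and> solves B' u \<longrightarrow>
           (\<forall>x\<in>smooth_points B'. weight_process B' D x Y \<longrightarrow> feynman_kac_formula B' D Y u x))"

text \<open>The expected hitting time of the absorbing boundary from \<open>x\<close>.\<close>

definition mean_exit_time :: "'d::finite bvp \<Rightarrow> ('w, 'd) diffusion \<Rightarrow> point \<Rightarrow> real" where
  "mean_exit_time B D x = enn2real (\<integral>\<^sup>+ \<omega>. hitting_time D (absorbing B) \<omega> \<partial>law D x)"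


section \<open>The discretisation\<close>

datatype direction = East | North | West | South

lemma UNIV_direction: "(UNIV :: direction set) = {East, North, West, South}"
  using direction.exhaust by auto

instance direction :: finite
  by standard (simp add: UNIV_direction)

fun dirvec :: "direction \<Rightarrow> point" where
  "dirvec East = axis 1 1"
| "dirvec North = axis 2 1"
| "dirvec West = - axis 1 1"
| "dirvec South = - axis 2 1"

text \<open>The knots are indexed by the finite type \<^typ>\<open>'n\<close>, whose cardinality is N;
  \<open>cardinal_fn K i e j\<close> is the function written with indices \<open>i j\<close> and superscript \<open>e\<close>.\<close>

record 'n discretisation =
  grid_origin :: point
  mesh :: real
  knot :: "'n \<Rightarrow> point"
  side :: "'n \<Rightarrow> direction \<Rightarrow> point set"
  stencil :: "'n \<Rightarrow> direction \<Rightarrow> 'n set"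
  cardinal_fn :: "'n \<Rightarrow> direction \<Rightarrow> 'n \<Rightarrow> point \<Rightarrow> real"

definition cell :: "'n discretisation \<Rightarrow> int \<times> int \<Rightarrow> point set" where
  "cell K z = {x.
     grid_origin K $ 1 + mesh K * fst z \<le> x $ 1 \<and> x $ 1 \<le> grid_origin K $ 1 + mesh K * (fst z + 1) \<and>
     grid_origin K $ 2 + mesh K * snd z \<le> x $ 2 \<and> x $ 2 \<le> grid_origin K $ 2 + mesh K * (snd z + 1)}"

definition crossings :: "'n discretisation \<Rightarrow> point set" where
  "crossings K = {x. \<exists>p q :: int.
     x $ 1 = grid_origin K $ 1 + mesh K * p \<and> x $ 2 = grid_origin K $ 2 + mesh K * q}"

definition subdomain :: "'d::finite bvp \<Rightarrow> 'n discretisation \<Rightarrow> int \<times> int \<Rightarrow> point set" where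
  "subdomain B K z = cell K z \<inter> region B"

definition interfaces :: "'d::finite bvp \<Rightarrow> 'n discretisation \<Rightarrow> point set" where
  "interfaces B K = (\<Union>{subdomain B K z \<inter> subdomain B K z' | z z'.
     \<bar>fst z - fst z'\<bar> + \<bar>snd z - snd z'\<bar> = 1})"

text \<open>Knots may lie on the boundary of the region, hence the closure.\<close>

definition patch :: "'d::finite bvp \<Rightarrow> 'n discretisation \<Rightarrow> 'n \<Rightarrow> point set" where
  "patch B K i = (\<Union>{subdomain B K z | z. knot K i \<in> closure (subdomain B K z)})"

text \<open>
  Sides are disjoint (a corner is counted to one of its sides), and side \<open>e\<close> bounds the patch in
  direction \<open>e\<close>. A stencil contains the knots on its side and possibly further knots on the
  line that carries the side.
\<close>

definition pdd_discretisation :: "'d::finite bvp \<Rightarrow> 'n::finite discretisation \<Rightarrow> bool" where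
  "pdd_discretisation B K \<longleftrightarrow>
     0 < mesh K \<and> inj (knot K) \<and>
     range (knot K) \<subseteq> closure (interfaces B K) \<and>
     crossings K \<inter> region B \<subseteq> range (knot K) \<and>
     closure (interfaces B K) \<inter> frontier (region B) \<subseteq> range (knot K) \<and>
     (\<forall>i. (\<Union>e\<in>UNIV. side K i e) = frontier (patch B K i) - frontier (region B)) \<and>
     (\<forall>i e e'. e \<noteq> e' \<longrightarrow> side K i e \<inter> side K i e' = {}) \<and>
     (\<forall>i e. side K i e \<in> sets borel) \<and>
     (\<forall>i e. \<exists>a. (\<forall>y \<in> side K i e \<union> knot K ` stencil K i e. dirvec e \<bullet> y = a) \<and>
                 (\<forall>y \<in> patch B K i. dirvec e \<bullet> y \<le> a)) \<and>
     (\<forall>i e. {j. knot K j \<in> side K i e} \<subseteq> stencil K i e \<and> i \<notin> stencil K i e) \<and>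
     (\<forall>i e. side K i e = {} \<longrightarrow> stencil K i e = {}) \<and>
     (\<forall>i e. \<forall>j\<in>stencil K i e. \<forall>k\<in>stencil K i e.
        cardinal_fn K i e j (knot K k) = (if j = k then 1 else 0)) \<and>
     (\<forall>i e. \<forall>j\<in>stencil K i e. continuous_on (closure (side K i e)) (cardinal_fn K i e j))"

text \<open>The stopping time of knot \<open>i\<close>: the patch is left through one of its sides, or the absorbing
  boundary is hit.\<close>

definition patch_absorbing :: "'d::finite bvp \<Rightarrow> 'n discretisation \<Rightarrow> 'n \<Rightarrow> point set" where
  "patch_absorbing B K i = (\<Union>e\<in>UNIV. side K i e) \<union> absorbing B"

definition patch_time ::
    "'d::finite bvp \<Rightarrow> ('w, 'd) diffusion \<Rightarrow> 'n discretisation \<Rightarrow> 'n \<Rightarrow> 'w \<Rightarrow> ennreal" where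
  "patch_time B D K i = hitting_time D (patch_absorbing B K i)"

definition mean_patch_time ::
    "'d::finite bvp \<Rightarrow> ('w, 'd) diffusion \<Rightarrow> 'n discretisation \<Rightarrow> 'n \<Rightarrow> real" where
  "mean_patch_time B D K i = enn2real (\<integral>\<^sup>+ \<omega>. patch_time B D K i \<omega> \<partial>law D (knot K i))"

text \<open>The geometry of the problem posed on a patch.  The absorbing boundary away from the patch is
  kept, which is harmless: it cannot be reached before a side of the patch.\<close>

definition patch_bvp :: "'d::finite bvp \<Rightarrow> 'n discretisation \<Rightarrow> 'n \<Rightarrow> 'd bvp" where
  "patch_bvp B K i = B\<lparr>region := interior (patch B K i),
     absorbing := patch_absorbing B K i,
     reflecting := reflecting B \<inter> frontier (interior (patch B K i))\<rparr>"

definition pdd_matrix ::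
    "'d::finite bvp \<Rightarrow> ('w, 'd) diffusion \<Rightarrow> 'n::finite discretisation \<Rightarrow> real^'n^'n" where
  "pdd_matrix B D K = (\<chi> i j.
     if i = j then 1
     else if knot K i \<in> absorbing B then 0
     else - (\<Sum>e\<in>{e. j \<in> stencil K i e}. LINT \<omega>|law D (knot K i).
              (let T = enn2real (patch_time B D K i \<omega>)
               in weight D T \<omega> * indicator (side K i e) (pos D T \<omega>)
                  * cardinal_fn K i e j (pos D T \<omega>))))"


section \<open>Standing assumptions\<close>

definition well_posed ::
    "'d::finite bvp \<Rightarrow> ('w, 'd) diffusion \<Rightarrow> 'n discretisation \<Rightarrow> bool" where
  "well_posed B D K \<longleftrightarrow>
     (\<exists>u. solves B u) \<and> feynman_kac_valid B D \<and>
     (\<forall>i. feynman_kac_valid (patch_bvp B K i) D) \<and>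
     (\<forall>x\<in>closure (region B).
        hitting_time D (absorbing B) \<in> borel_measurable (law D x) \<and>
        (\<integral>\<^sup>+ \<omega>. hitting_time D (absorbing B) \<omega> \<partial>law D x) < \<infinity>) \<and>
     (\<forall>i. patch_time B D K i \<in> borel_measurable (law D (knot K i))) \<and>
     solves (exit_time_bvp B) (mean_exit_time B D)"

definition exact_interpolation ::
    "'d::finite bvp \<Rightarrow> ('w, 'd) diffusion \<Rightarrow> 'n::finite discretisation \<Rightarrow> bool" where
  "exact_interpolation B D K \<longleftrightarrow>
     (\<forall>\<alpha> \<beta> i e. \<forall>x\<in>side K i e.
        let u = (\<lambda>y. \<alpha> + \<beta> * mean_exit_time B D y)
        in u x = (\<Sum>j\<in>stencil K i e. u (knot K j) * cardinal_fn K i e j x))"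

definition spectral_radius :: "real^'n^'n::finite \<Rightarrow> real" where
  "spectral_radius A = Max {cmod k | k. \<exists>v :: complex^'n. v \<noteq> 0 \<and>
     (\<chi> i j. complex_of_real (A $ i $ j)) *v v = k *s v}"

definition invertible_M_matrix :: "real^'n^'n::finite \<Rightarrow> bool" where
  "invertible_M_matrix G \<longleftrightarrow>
     (\<exists>A. G = mat 1 - A \<and> (\<forall>i j. 0 \<le> A $ i $ j) \<and> spectral_radius A < 1)"

text \<open>The operator norm induced by the maximum norm on vectors.\<close>

definition matrix_infnorm :: "real^'n^'n::finite \<Rightarrow> real" where
  "matrix_infnorm A = (SUP x. infnorm (A *v x) / infnorm x)"

end

theory Submission
  imports Defs
begin

text \<open>
  Let \<open>v\<close> be the expected time to absorption, \<open>m\<close> the smallest expected patch time and \<open>G\<close> the matrix.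
  The inverse of a matrix with nonpositive off-diagonal entries is controlled by a barrier: if
  \<open>w \<ge> 0\<close> and \<open>G w \<ge> 1\<close>, then \<open>G\<close> is invertible and the norm of its inverse is at most \<open>max w\<close>
  (\<open>matrix_infnorm_inverse_le\<close>).  The barrier is \<open>w = 1 + v / m\<close>.

  That it is one rests on probability.  Interpolation is exact on \<open>u = \<alpha> + \<beta> v\<close>, hence a
  row of \<open>G\<close> acts on such a \<open>u\<close> as
  \<open>(G u)\<^sub>i = u(x\<^sub>i) - E[Y u(X); X on a side]\<close>, where \<open>X\<close> and \<open>Y\<close> are the position and the
  weight at the patch time (\<open>matrix_row\<close>).  The weight is between 0 and 1 because the zeroth-order
  coefficients are nonpositive (\<open>weight_nonneg_le_1\<close>), so \<open>G 1 \<ge> 0\<close>.  The Feynman-Kac formula on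
  the patch, with \<open>v\<close> itself as boundary data, gives \<open>v(x\<^sub>i) = E[patch time] + E[v(X)]\<close>
  (\<open>mean_exit_time_splits\<close>), so \<open>(G v)\<^sub>i\<close> is at least the expected patch time, hence at least \<open>m\<close>.  In the
  rows of absorbing knots \<open>G\<close> is the identity and \<open>v = 0\<close>.  Altogether \<open>G w \<ge> 1\<close>.

  The bound needs \<open>m > 0\<close> and the knot to be a point where the Feynman-Kac formula holds on
  its patch.  Both follow from geometry: the grid is locally finite, so near a knot its patch fills
  the region, and the sides and the absorbing boundary stay away from the knot.  This is where
  knots at meeting points of the two parts of the boundary are excluded.

  The maximum of \<open>v\<close> that results is over all knots off the absorbing boundary.  It may be taken over interior
  knots if reflecting knots are dominated by interior ones, or if the stencils contain interior
  knots only; in the latter case a modified barrier is used (\<open>interior_stencil_barrier\<close>).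
\<close>

section \<open>Comparison for matrices with nonpositive off-diagonal entries\<close>

text \<open>
  The minimum of \<open>x / w\<close> over the indices cannot be negative: if it is \<open>t < 0\<close>, attained at
  \<open>i\<close>, then \<open>x - t w\<close> is nonnegative and vanishes at \<open>i\<close>, so row \<open>i\<close> of \<open>G\<close>, whose only possibly
  positive entry is the diagonal one, maps it to something nonpositive; but
  \<open>G x - t G w\<close> is positive there.
\<close>

lemma comparison_principle:
  fixes G :: "real^'n^'n"
  assumes off: "\<And>i j. i \<noteq> j \<Longrightarrow> G $ i $ j \<le> 0"
    and w: "\<And>i. 0 \<le> w $ i" "\<And>i. 1 \<le> (G *v w) $ i"
    and x: "\<And>i. 0 \<le> (G *v x) $ i"
  shows "0 \<le> x $ k"
proof (rule ccontr)
  have row: "(G *v y) $ i = G $ i $ i * y $ i + (\<Sum>j\<in>UNIV - {i}. G $ i $ j * y $ j)" for y i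
    by (simp add: matrix_vector_mult_def sum.remove[of UNIV i])
  have pos: "0 < w $ i" for i
  proof -
    have "(\<Sum>j\<in>UNIV - {i}. G $ i $ j * w $ j) \<le> 0"
      using off w(1) by (intro sum_nonpos) (auto intro: mult_nonpos_nonneg)
    then have "w $ i \<noteq> 0" using row[of w i] w(2)[of i] by auto
    then show ?thesis using w(1)[of i] by simp
  qed
  define t where "t = Min (range (\<lambda>i. x $ i / w $ i))"
  have "t \<in> range (\<lambda>i. x $ i / w $ i)" unfolding t_def by (rule Min_in) auto
  then obtain i where i: "t = x $ i / w $ i" by auto
  have le: "t \<le> x $ j / w $ j" for j unfolding t_def by (rule Min_le) auto
  assume "\<not> 0 \<le> x $ k"
  then have "x $ k / w $ k < 0" using pos by (simp add: divide_neg_pos)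
  then have t: "t < 0" using le[of k] by simp
  define y where "y = x - t *\<^sub>R w"
  have y0: "y $ i = 0" using i pos[of i] by (simp add: y_def)
  have ynn: "0 \<le> y $ j" for j using le[of j] pos[of j] by (simp add: y_def field_simps)
  have "(G *v y) $ i \<le> 0"
    unfolding row y0 using off ynn by (auto intro!: sum_nonpos mult_nonpos_nonneg)
  moreover have "(G *v y) $ i = (G *v x) $ i - t * (G *v w) $ i"
    by (simp add: y_def matrix_vector_mult_diff_distrib scaleR_matrix_vector_assoc[symmetric]
        matrix_vector_mult_scaleR)
  moreover have "t * (G *v w) $ i < 0" using t w(2)[of i] by (simp add: mult_less_0_iff)
  ultimately show False using x[of i] by linarith
qed

text \<open>
  Comparing \<open>G\<inverse> x\<close> with \<open>\<plusminus> \<parallel>x\<parallel> w\<close> bounds it componentwise by \<open>\<parallel>x\<parallel> w\<close>.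
\<close>

lemma matrix_infnorm_inverse_le:
  fixes G :: "real^'n^'n"
  assumes off: "\<And>i j. i \<noteq> j \<Longrightarrow> G $ i $ j \<le> 0"
    and w: "\<And>i. 0 \<le> w $ i" "\<And>i. 1 \<le> (G *v w) $ i" "\<And>i. w $ i \<le> C"
  shows "matrix_infnorm (matrix_inv G) \<le> C"
proof -
  have cp: "0 \<le> x $ k" if "\<And>i. 0 \<le> (G *v x) $ i" for x k
    by (rule comparison_principle[OF _ w(1,2)]) (use off that in auto)
  have "x = 0" if "G *v x = 0" for x
  proof -
    have "0 \<le> x $ k" for k by (rule cp) (subst that, simp)
    moreover have "0 \<le> (0 - x) $ k" for k
      by (rule cp) (simp add: that matrix_vector_mult_diff_distrib del: diff_0)
    ultimately show ?thesis by (simp add: vec_eq_iff antisym)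
  qed
  then have "invertible G"
    by (simp add: invertible_left_inverse matrix_left_invertible_ker)
  then have inv: "G ** matrix_inv G = mat 1"
    unfolding matrix_inv_def invertible_def by (rule someI2_ex) simp
  have C0: "0 \<le> C" using w(1,3) order_trans by blast
  have "infnorm (matrix_inv G *v x) / infnorm x \<le> C" for x
  proof (cases "x = 0")
    case False
    define y where "y = matrix_inv G *v x"
    define r where "r = infnorm x"
    have r: "0 < r" "\<And>i. \<bar>x $ i\<bar> \<le> r"
      using False by (auto simp: r_def infnorm_pos_lt component_le_infnorm_cart)
    have Gy: "G *v y = x" by (simp add: y_def matrix_vector_mul_assoc inv)
    have rw: "r \<le> r * (G *v w) $ i" for i using mult_left_mono[OF w(2)[of i], of r] r(1) by simp
    have "0 \<le> (r *\<^sub>R w - y) $ k" for k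
    proof (rule cp)
      show "0 \<le> (G *v (r *\<^sub>R w - y)) $ i" for i
        using rw[of i] r(2)[of i]
        by (simp add: matrix_vector_mult_diff_distrib matrix_vector_mult_scaleR Gy)
    qed
    moreover have "0 \<le> (r *\<^sub>R w + y) $ k" for k
    proof (rule cp)
      show "0 \<le> (G *v (r *\<^sub>R w + y)) $ i" for i
        using rw[of i] r(2)[of i]
        by (simp add: matrix_vector_right_distrib matrix_vector_mult_scaleR Gy)
    qed
    ultimately have "\<bar>y $ k\<bar> \<le> r * w $ k" for k
      by (simp add: abs_le_iff) (smt (verit, ccfv_SIG))
    then have "\<bar>y $ k\<bar> \<le> r * C" for k
      using mult_left_mono[OF w(3)[of k], of r] r(1) by (meson less_imp_le order_trans)
    then have "infnorm y \<le> r * C"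
      unfolding infnorm_cart by (intro cSup_least) auto
    then show ?thesis using r(1) by (simp add: y_def r_def field_simps)
  qed (simp add: C0 infnorm_0)
  then show ?thesis unfolding matrix_infnorm_def by (intro cSUP_least) auto
qed

section \<open>Paths, weights and hitting times\<close>

text \<open>
  The weight solves a linear Volterra equation against \<open>c dt + p d\<mu>\<close> with nonpositive coefficients.
  It cannot become negative: after the last time \<open>s\<close> at which it was nonnegative its increments
  \<open>c y\<close> and \<open>p y\<close> would be nonnegative.  Once it is known to be nonnegative, its increments are
  nonpositive, so it stays below its initial value 1.  The sign of \<open>p\<close> is only available before \<open>\<tau>\<close>, so
  the bounds reach the time \<open>\<tau>\<close> itself by continuity, which is why \<open>\<tau>\<close> must be positive.
\<close>

lemma weight_nonneg_le_1:
  fixes y c p :: "real \<Rightarrow> real" and \<mu> :: "real measure" and \<tau> :: ennreal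
  assumes sets: "sets \<mu> = sets borel" and cont: "continuous_on {0..} y" and "0 < \<tau>"
    and c: "\<And>t. 0 \<le> t \<Longrightarrow> c t \<le> 0"
    and p: "AE t in \<mu>. 0 \<le> t \<and> ennreal t < \<tau> \<longrightarrow> p t \<le> 0"
    and eq: "\<And>t. 0 \<le> t \<Longrightarrow> ennreal t \<le> \<tau> \<Longrightarrow>
        set_integrable lborel {0..t} (\<lambda>s. c s * y s) \<and> set_integrable \<mu> {0..t} (\<lambda>s. p s * y s) \<and>
        y t = 1 + (LINT s:{0..t}|lborel. c s * y s) + (LINT s:{0..t}|\<mu>. p s * y s)"
    and t: "0 \<le> t" "ennreal t \<le> \<tau>"
  shows "0 \<le> y t \<and> y t \<le> 1"
proof -
  have before: "ennreal s < \<tau>" if "0 \<le> s" "s \<le> r" "ennreal r < \<tau>" for s r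
    using that by (meson ennreal_leI le_less_trans)
  have int_nn: "0 \<le> (LINT s:A|lborel. c s * y s)" "0 \<le> (LINT s:A|\<mu>. p s * y s)"
    if A: "A \<subseteq> {0..r}" "ennreal r < \<tau>" and neg: "\<And>s. s \<in> A \<Longrightarrow> y s \<le> 0" for A r
  proof -
    show "0 \<le> (LINT s:A|lborel. c s * y s)"
      unfolding set_lebesgue_integral_def
      by (rule integral_nonneg_AE)
        (use A neg c in \<open>auto simp: indicator_def intro!: mult_nonpos_nonpos AE_I2\<close>)
    show "0 \<le> (LINT s:A|\<mu>. p s * y s)"
      unfolding set_lebesgue_integral_def
      by (rule integral_nonneg_AE, use p in eventually_elim)
        (use A neg before[OF _ _ A(2)] in \<open>auto simp: indicator_def subset_eq intro!: mult_nonpos_nonpos\<close>)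
  qed
  have nn: "0 \<le> y r" if r: "0 \<le> r" "ennreal r < \<tau>" for r
  proof (rule ccontr)
    assume "\<not> 0 \<le> y r"
    then have yr: "y r < 0" by simp
    \<comment> \<open>If \<open>P\<close> is empty, then \<open>y\<close> is negative on all of \<open>[0, r]\<close>.  This possibility has to be treated even at
        \<open>r = 0\<close>, as \<open>\<mu>\<close> may have an atom at 0.\<close>
    define P where "P = {s\<in>{0..r}. 0 \<le> y s}"
    show False
    proof (cases "P = {}")
      case True
      then have "y s \<le> 0" if "s \<in> {0..r}" for s using that by (auto simp: P_def)
      then have "1 \<le> y r" using eq[of r] int_nn[of "{0..r}" r] r by auto
      then show False using yr by simp
    next
      case False
      have contr: "continuous_on {0..r} y" by (rule continuous_on_subset[OF cont]) auto
      have "P = {0..r} \<inter> y -` {0..}" by (auto simp: P_def)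
      then have "closed P" using contr by (simp add: continuous_closed_preimage)
      moreover have bdd: "bdd_above P" unfolding P_def by (rule bdd_aboveI[of _ r]) auto
      ultimately have "Sup P \<in> P" using False closed_contains_Sup by blast
      then obtain s where s: "s = Sup P" "0 \<le> s" "s \<le> r" "0 \<le> y s" by (auto simp: P_def)
      have neg: "y u \<le> 0" if "u \<in> {s<..r}" for u
      proof (rule ccontr)
        assume "\<not> y u \<le> 0"
        then have "u \<in> P" using that s by (auto simp: P_def)
        then show False using cSup_upper[OF _ bdd, of u] that s(1) by auto
      qed
      have un: "{0..r} = {0..s} \<union> {s<..r}" using s by auto
      note er = eq[OF r(1) less_imp_le[OF r(2)]]
      note es = eq[OF s(2) less_imp_le[OF before[OF s(2,3) r(2)]]]
      have split: "(LINT u:{0..r}|M. f u) = (LINT u:{0..s}|M. f u) + (LINT u:{s<..r}|M. f u)"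
        if "set_integrable M {0..r} f" "sets M = sets borel" for M and f :: "real \<Rightarrow> real"
        unfolding un
        by (rule set_integral_Un) (use that s in \<open>auto intro: set_integrable_subset\<close>)
      have "y r = y s + (LINT u:{s<..r}|lborel. c u * y u) + (LINT u:{s<..r}|\<mu>. p u * y u)"
        using er es split[of lborel] split[of \<mu>] sets by auto
      moreover have "0 \<le> (LINT u:{s<..r}|lborel. c u * y u)" "0 \<le> (LINT u:{s<..r}|\<mu>. p u * y u)"
        using int_nn[OF _ r(2), of "{s<..r}"] neg un by blast+
      ultimately show False using yr s(4) by linarith
    qed
  qed
  have le: "y r \<le> 1" if r: "0 \<le> r" "ennreal r < \<tau>" for r
  proof -
    have "0 \<le> (LINT s:{0..r}|lborel. - (c s * y s))"
      unfolding set_lebesgue_integral_def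
      by (rule integral_nonneg_AE)
        (use nn c before[OF _ _ r(2)] in \<open>auto simp: indicator_def intro!: mult_nonpos_nonneg AE_I2\<close>)
    moreover have "0 \<le> (LINT s:{0..r}|\<mu>. - (p s * y s))"
      unfolding set_lebesgue_integral_def
      by (rule integral_nonneg_AE, use p in eventually_elim)
        (use nn before[OF _ _ r(2)] in \<open>auto simp: indicator_def intro!: mult_nonpos_nonneg\<close>)
    ultimately show ?thesis using eq[of r] r by (auto simp: set_lebesgue_integral_def)
  qed
  show ?thesis
  proof (cases "ennreal t < \<tau>")
    case True
    then show ?thesis using nn le t by auto
  next
    case False
    then have \<tau>: "\<tau> = ennreal t" using t by auto
    then have t0: "0 < t" using \<open>0 < \<tau>\<close> by simp
    have "continuous_on {0..t} y" by (rule continuous_on_subset[OF cont]) auto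
    then have lim: "(y \<longlongrightarrow> y t) (at_left t)" using t0 by (simp add: continuous_on_Icc_at_leftD)
    have ev: "eventually (\<lambda>s. 0 \<le> y s \<and> y s \<le> 1) (at_left t)"
      unfolding eventually_at_left[OF t0]
      using t0 nn le \<tau> by (intro exI[of _ 0]) (auto simp: ennreal_less_iff)
    show ?thesis
      using tendsto_lowerbound[OF lim, of 0] tendsto_upperbound[OF lim, of 1] ev
      by (simp add: eventually_conj_iff)
  qed
qed

text \<open>
  Rounding the random time up to a multiple of \<open>1 / (n + 1)\<close> gives countably many values, hence a
  measurable composition; the continuity of the paths takes the limit.
\<close>

lemma borel_measurable_at_random_time:
  fixes X :: "real \<Rightarrow> 'w \<Rightarrow> 'b::euclidean_space" and T :: "'w \<Rightarrow> real"
  assumes X: "\<And>t. 0 \<le> t \<Longrightarrow> X t \<in> borel_measurable M"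
    and cont: "\<And>\<omega>. \<omega> \<in> space M \<Longrightarrow> continuous_on {0..} (\<lambda>t. X t \<omega>)"
    and T: "T \<in> borel_measurable M" "\<And>\<omega>. 0 \<le> T \<omega>"
  shows "(\<lambda>\<omega>. X (T \<omega>) \<omega>) \<in> borel_measurable M"
proof (rule borel_measurable_LIMSEQ_metric)
  define R where "R n \<omega> = real (nat \<lceil>T \<omega> * real (Suc n)\<rceil>) / real (Suc n)" for n \<omega>
  show "(\<lambda>\<omega>. X (R n \<omega>) \<omega>) \<in> borel_measurable M" for n
    unfolding R_def
  proof (rule measurable_compose_countable[where g = "\<lambda>\<omega>. nat \<lceil>T \<omega> * real (Suc n)\<rceil>"
        and f = "\<lambda>k \<omega>. X (real k / real (Suc n)) \<omega>"])
    show "X (real k / real (Suc n)) \<in> borel_measurable M" for k by (rule X) simp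
    show "(\<lambda>\<omega>. nat \<lceil>T \<omega> * real (Suc n)\<rceil>) \<in> measurable M (count_space UNIV)"
      using T by measurable
  qed
  fix \<omega> assume \<omega>: "\<omega> \<in> space M"
  have bounds: "T \<omega> \<le> R n \<omega> \<and> R n \<omega> \<le> T \<omega> + inverse (real (Suc n))" for n
  proof -
    have "0 \<le> T \<omega> * real (Suc n)" using T by simp
    then have "T \<omega> * real (Suc n) \<le> real (nat \<lceil>T \<omega> * real (Suc n)\<rceil>)"
      "real (nat \<lceil>T \<omega> * real (Suc n)\<rceil>) \<le> T \<omega> * real (Suc n) + 1"
      by linarith+
    then have "T \<omega> * real (Suc n) / real (Suc n) \<le> R n \<omega>"
      "R n \<omega> \<le> (T \<omega> * real (Suc n) + 1) / real (Suc n)"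
      unfolding R_def by (intro divide_right_mono; simp)+
    then show ?thesis by (simp add: add_divide_distrib inverse_eq_divide)
  qed
  have "(\<lambda>n. R n \<omega>) \<longlonglongrightarrow> T \<omega>"
  proof (rule tendsto_sandwich[of "\<lambda>_. T \<omega>"])
    show "(\<lambda>n. T \<omega> + inverse (real (Suc n))) \<longlonglongrightarrow> T \<omega>"
      using tendsto_add[OF tendsto_const LIMSEQ_inverse_real_of_nat, of "T \<omega>"] by simp
  qed (use bounds in \<open>auto simp del: of_nat_Suc\<close>)
  moreover have "R n \<omega> \<in> {0..}" for n by (simp add: R_def)
  ultimately show "(\<lambda>n. X (R n \<omega>) \<omega>) \<longlonglongrightarrow> X (T \<omega>) \<omega>"
    using cont[OF \<omega>] T(2)[of \<omega>]
    unfolding continuous_on_sequentially comp_def by auto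
qed

lemma hitting_time_antimono:
  "S \<subseteq> S' \<Longrightarrow> hitting_time D S' \<omega> \<le> hitting_time D S \<omega>"
  unfolding hitting_time_def by (rule INF_superset_mono) auto

lemma hitting_time_pos:
  assumes cont: "continuous_on {0..} (\<lambda>t. pos D t \<omega>)" and start: "pos D 0 \<omega> \<notin> closure S"
  shows "0 < hitting_time D S \<omega>"
proof -
  have "((\<lambda>t. pos D t \<omega>) \<longlongrightarrow> pos D 0 \<omega>) (at 0 within {0..})"
    using cont by (simp add: continuous_on_def)
  then have "eventually (\<lambda>t. pos D t \<omega> \<in> - closure S) (at 0 within {0..})"
    using start by (intro topological_tendstoD) auto
  then obtain d where d: "0 < d" "\<And>t. 0 \<le> t \<Longrightarrow> t \<noteq> 0 \<Longrightarrow> dist t 0 < d \<Longrightarrow> pos D t \<omega> \<notin> closure S"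
    unfolding eventually_at by auto
  have far: "pos D t \<omega> \<notin> S" if "0 \<le> t" "t < d" for t
    using d(2)[of t] start that closure_subset[of S] by (cases "t = 0") auto
  have "ennreal d \<le> hitting_time D S \<omega>"
    unfolding hitting_time_def by (rule INF_greatest) (use far in \<open>force intro: ennreal_leI\<close>)
  then show ?thesis using d(1) by (meson ennreal_less_zero_iff less_le_trans)
qed

section \<open>Geometry of the patches\<close>

lemma mem_some_cell:
  assumes "0 < mesh K"
  shows "\<exists>z. y \<in> cell K z"
proof -
  have *: "\<exists>p::int. a + mesh K * real_of_int p \<le> t \<and> t \<le> a + mesh K * (real_of_int p + 1)" for a t :: real
  proof (rule exI[of _ "\<lfloor>(t - a) / mesh K\<rfloor>"])
    have "(t - a) / mesh K \<le> real_of_int \<lfloor>(t - a) / mesh K\<rfloor> + 1"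
      "real_of_int \<lfloor>(t - a) / mesh K\<rfloor> \<le> (t - a) / mesh K" by linarith+
    then have "t - a \<le> (real_of_int \<lfloor>(t - a) / mesh K\<rfloor> + 1) * mesh K"
      "real_of_int \<lfloor>(t - a) / mesh K\<rfloor> * mesh K \<le> t - a"
      using assms by (simp_all only: pos_divide_le_eq pos_le_divide_eq)
    then show "a + mesh K * real_of_int \<lfloor>(t - a) / mesh K\<rfloor> \<le> t \<and>
        t \<le> a + mesh K * (real_of_int \<lfloor>(t - a) / mesh K\<rfloor> + 1)"
      by (simp add: algebra_simps)
  qed
  obtain p q :: int where
    "grid_origin K $ 1 + mesh K * p \<le> y $ 1" "y $ 1 \<le> grid_origin K $ 1 + mesh K * (p + 1)"
    "grid_origin K $ 2 + mesh K * q \<le> y $ 2" "y $ 2 \<le> grid_origin K $ 2 + mesh K * (q + 1)"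
    using *[of "grid_origin K $ 1" "y $ 1"] *[of "grid_origin K $ 2" "y $ 2"] by auto
  then show ?thesis by (intro exI[of _ "(p, q)"]) (simp add: cell_def)
qed

text \<open>
  Local finiteness of the grid: without it, subdomains that each stay away from a knot could still
  accumulate there.
\<close>

lemma finite_cells_meeting_ball:
  assumes "0 < mesh K"
  shows "finite {z. cell K z \<inter> ball x 1 \<noteq> {}}"
proof -
  define S where "S k = {\<lfloor>(x $ k - 1 - grid_origin K $ k) / mesh K\<rfloor> - 1 ..
      \<lceil>(x $ k + 1 - grid_origin K $ k) / mesh K\<rceil>}" for k
  have range: "p \<in> S k" if "\<bar>t - x $ k\<bar> \<le> 1" "grid_origin K $ k + mesh K * p \<le> t"
    "t \<le> grid_origin K $ k + mesh K * (p + 1)" for p :: int and t k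
  proof -
    have "mesh K * p \<le> x $ k + 1 - grid_origin K $ k"
      "x $ k - 1 - grid_origin K $ k \<le> mesh K * (p + 1)" using that by linarith+
    then have "p \<le> (x $ k + 1 - grid_origin K $ k) / mesh K"
      "(x $ k - 1 - grid_origin K $ k) / mesh K \<le> p + 1"
      using assms by (simp_all add: field_simps)
    then show ?thesis unfolding S_def atLeastAtMost_iff by linarith
  qed
  have "z \<in> S 1 \<times> S 2" if "y \<in> cell K z" "y \<in> ball x 1" for z y
  proof -
    have "\<bar>y $ k - x $ k\<bar> \<le> 1" for k
      using component_le_norm_cart[of "y - x" k] that(2)
      by (simp add: dist_norm norm_minus_commute)
    then show ?thesis using range[of "y $ 1" 1 "fst z"] range[of "y $ 2" 2 "snd z"] that(1)
      by (cases z) (simp add: cell_def)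
  qed
  then have "{z. cell K z \<inter> ball x 1 \<noteq> {}} \<subseteq> S 1 \<times> S 2" by blast
  moreover have "finite (S k)" for k by (simp add: S_def)
  ultimately show ?thesis by (meson finite_SigmaI finite_subset)
qed

lemma patch_subset_region: "patch B K i \<subseteq> region B"
  by (auto simp: patch_def subdomain_def)

text \<open>
  Only finitely many cells come near the knot, and those whose subdomain does not have the knot in its
  closure stay at a positive distance.  Everything else in the region near the knot is therefore in
  the patch.  This treats knots inside the region and on its boundary alike.
\<close>

lemma patch_fills_neighbourhood:
  assumes "0 < mesh K"
  obtains U where "open U" "knot K i \<in> U" "U \<inter> region B \<subseteq> patch B K i"
proof -
  define F where "F = {z. cell K z \<inter> ball (knot K i) 1 \<noteq> {}}"
  define U where "U = ball (knot K i) 1 -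
    (\<Union>z\<in>{z\<in>F. knot K i \<notin> closure (subdomain B K z)}. closure (subdomain B K z))"
  have "finite F" unfolding F_def by (rule finite_cells_meeting_ball[OF assms])
  then have "open U" unfolding U_def by (intro open_Diff closed_UN) auto
  moreover have "knot K i \<in> U" by (auto simp: U_def)
  moreover have "U \<inter> region B \<subseteq> patch B K i"
  proof
    fix y assume y: "y \<in> U \<inter> region B"
    obtain z where z: "y \<in> cell K z" using mem_some_cell[OF assms] by blast
    have yz: "y \<in> subdomain B K z" using y z by (simp add: subdomain_def)
    have "y \<in> closure (subdomain B K z)" using yz closure_subset by blast
    moreover have "z \<in> F" using y z by (auto simp: F_def U_def)
    ultimately have "knot K i \<in> closure (subdomain B K z)" using y unfolding U_def by blast
    then show "y \<in> patch B K i" using yz unfolding patch_def by blast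
  qed
  ultimately show ?thesis by (rule that)
qed

lemma
  assumes "elliptic_bvp B"
  shows open_region: "open (region B)"
    and boundary_split: "absorbing B \<union> reflecting B = frontier (region B)"
    and boundary_disjoint: "absorbing B \<inter> reflecting B = {}"
  using assms by (auto simp: elliptic_bvp_def)

context
  fixes B :: "'d::finite bvp" and K :: "'n::finite discretisation"
  assumes elliptic: "elliptic_bvp B" and pdd: "pdd_discretisation B K"
begin

lemma knot_in_closure: "knot K i \<in> closure (region B)"
proof -
  have "interfaces B K \<subseteq> region B" by (auto simp: interfaces_def subdomain_def)
  then have "closure (interfaces B K) \<subseteq> closure (region B)" by (rule closure_mono)
  moreover have "range (knot K) \<subseteq> closure (interfaces B K)"
    using pdd by (simp add: pdd_discretisation_def)
  ultimately show ?thesis by blast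
qed

lemma patch_fills:
  obtains U where "open U" "knot K i \<in> U" "U \<inter> region B \<subseteq> interior (patch B K i)"
proof -
  have "0 < mesh K" using pdd by (simp add: pdd_discretisation_def)
  then obtain U where U: "open U" "knot K i \<in> U" "U \<inter> region B \<subseteq> patch B K i"
    by (rule patch_fills_neighbourhood)
  moreover have "U \<inter> region B \<subseteq> interior (patch B K i)"
    using U(1,3) open_region[OF elliptic] by (intro interior_maximal) auto
  ultimately show ?thesis by (intro that)
qed

lemma sides_eq: "(\<Union>e\<in>UNIV. side K i e) = frontier (patch B K i) - frontier (region B)"
  using pdd by (simp add: pdd_discretisation_def)

lemma frontier_patch_subset: "frontier (patch B K i) \<subseteq> closure (region B)"
  using closure_mono[OF patch_subset_region[of B K i]] unfolding frontier_def by blast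

lemma patch_absorbing_subset: "patch_absorbing B K i \<subseteq> closure (region B)"
  using frontier_patch_subset[of i] boundary_split[OF elliptic]
  unfolding patch_absorbing_def sides_eq frontier_def by blast

text \<open>
  Near its knot the patch coincides with the region, so the frontier of the patch is there the frontier
  of the region and contains no side.  A knot in the closure of the absorbing boundary is either
  absorbing or a point where the two parts of the boundary meet.
\<close>

lemma knot_not_in_closure_patch_absorbing:
  assumes na: "knot K i \<notin> absorbing B"
    and meet: "knot K i \<notin> closure (absorbing B) \<inter> closure (reflecting B)"
  shows "knot K i \<notin> closure (patch_absorbing B K i)"
proof -
  obtain U where U: "open U" "knot K i \<in> U" "U \<inter> region B \<subseteq> interior (patch B K i)"
    by (rule patch_fills)
  have "U \<inter> (\<Union>e\<in>UNIV. side K i e) = {}"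
    unfolding sides_eq using U frontier_patch_subset[of i] open_region[OF elliptic]
    by (auto simp: frontier_def interior_open)
  then have 1: "knot K i \<notin> closure (\<Union>e\<in>UNIV. side K i e)"
    using U(1,2) open_Int_closure_eq_empty by blast
  have 2: "knot K i \<notin> closure (absorbing B)"
  proof
    assume a: "knot K i \<in> closure (absorbing B)"
    have "closure (absorbing B) \<subseteq> frontier (region B)"
      using boundary_split[OF elliptic] by (intro closure_minimal) auto
    then have "knot K i \<in> reflecting B" using a na boundary_split[OF elliptic] by auto
    then show False using a meet closure_subset[of "reflecting B"] by auto
  qed
  show ?thesis unfolding patch_absorbing_def closure_Un using 1 2 by simp
qed

text \<open>
  The Feynman-Kac formula on the patch may be evaluated at the knot, even if the knot is on the
  reflecting boundary.
\<close>

lemma knot_smooth_point: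
  assumes na: "knot K i \<notin> absorbing B"
    and meet: "knot K i \<notin> closure (absorbing B) \<inter> closure (reflecting B)"
  shows "knot K i \<in> smooth_points (patch_bvp B K i)"
proof -
  obtain U where U: "open U" "knot K i \<in> U" "U \<inter> region B \<subseteq> interior (patch B K i)"
    by (rule patch_fills)
  show ?thesis
  proof (cases "knot K i \<in> region B")
    case True
    then show ?thesis using U by (auto simp: smooth_points_def patch_bvp_def)
  next
    case False
    then have refl: "knot K i \<in> reflecting B"
      using na knot_in_closure[of i] boundary_split[OF elliptic] open_region[OF elliptic]
      by (auto simp: frontier_def interior_open)
    have "knot K i \<in> closure (U \<inter> region B)"
      using U(1,2) knot_in_closure[of i] open_Int_closure_subset[of U "region B"] by blast
    then have "knot K i \<in> closure (interior (patch B K i))"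
      using closure_mono[OF U(3)] by blast
    moreover have "knot K i \<notin> interior (patch B K i)"
      using False patch_subset_region[of B K i] interior_subset[of "patch B K i"] by auto
    ultimately have "knot K i \<in> frontier (interior (patch B K i))"
      by (simp add: frontier_def)
    then show ?thesis
      using refl knot_not_in_closure_patch_absorbing[OF assms]
      by (simp add: smooth_points_def patch_bvp_def)
  qed
qed

end

section \<open>The exit-time problem on a patch\<close>

text \<open>
  The exit-time problem localises: on the patch its solution \<open>v\<close> satisfies the same equation and
  the same reflecting condition, and trivially has its own values as boundary data on the sides.
\<close>

lemma solves_exit_time_on_patch:
  assumes sol: "solves (exit_time_bvp B) v"
    and g: "\<And>x. x \<in> closure (region B) \<Longrightarrow> g x = v x"
  shows "solves ((patch_bvp B K i)\<lparr>c_coeff := \<lambda>_. 0, f_data := \<lambda>_. 1, g_data := g,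
           phi_coeff := \<lambda>_. 0, psi_data := \<lambda>_. 0\<rparr>) v" (is "solves ?P v")
proof -
  let ?E = "exit_time_bvp B"
  have int: "interior (patch B K i) \<subseteq> region B"
    using patch_subset_region[of B K i] interior_subset[of "patch B K i"] by auto
  have cl: "closure (region ?P) \<subseteq> closure (region B)"
    using closure_mono[OF int] by (simp add: patch_bvp_def)
  have "reflecting ?P - closure (absorbing ?P) \<subseteq> reflecting B - closure (absorbing B)"
    using closure_mono[of "absorbing B" "patch_absorbing B K i"]
    by (auto simp: patch_bvp_def patch_absorbing_def)
  then have refl: "reflecting ?P - closure (absorbing ?P) \<subseteq>
      reflecting ?E - closure (absorbing ?E)"
    by (simp add: exit_time_bvp_def)
  have sm: "smooth_points ?P \<subseteq> smooth_points ?E"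
    using refl int by (auto simp: smooth_points_def patch_bvp_def exit_time_bvp_def)
  have reg: "region ?P \<subseteq> region ?E" using int by (simp add: patch_bvp_def exit_time_bvp_def)
  have cf: "a_coeff ?P = a_coeff ?E" "drift_coeff ?P = drift_coeff ?E"
    "c_coeff ?P = c_coeff ?E" "f_data ?P = f_data ?E"
    "phi_coeff ?P = phi_coeff ?E" "psi_data ?P = psi_data ?E"
    "outer_normal ?P = outer_normal ?E"
    by (auto simp: fun_eq_iff a_coeff_def patch_bvp_def exit_time_bvp_def)
  obtain p H where
    pH: "\<forall>x\<in>smooth_points ?E. (v has_derivative (\<lambda>h. p x \<bullet> h)) (at x within smooth_points ?E)"
     "\<forall>x\<in>smooth_points ?E. (p has_derivative (\<lambda>h. H x *v h)) (at x within smooth_points ?E)"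
     "continuous_on (smooth_points ?E) H"
     "\<forall>x\<in>region ?E.
           (1/2) * (\<Sum>i\<in>UNIV. \<Sum>j\<in>UNIV. a_coeff ?E x $ i $ j * H x $ i $ j)
           + (\<Sum>k\<in>UNIV. drift_coeff ?E x $ k * p x $ k) + c_coeff ?E x * v x
           + f_data ?E x = 0"
     "\<forall>x\<in>reflecting ?E - closure (absorbing ?E).
           outer_normal ?E x \<bullet> p x = phi_coeff ?E x * v x + psi_data ?E x"
    using sol unfolding solves_def by blast
  have "continuous_on (closure (region B)) v"
    using sol by (simp add: solves_def exit_time_bvp_def)
  then have "continuous_on (closure (region ?P)) v" using cl continuous_on_subset by blast
  moreover have "v x = g_data ?P x" if "x \<in> absorbing ?P \<inter> closure (region ?P)" for x
    using that cl g by auto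
  moreover have "(v has_derivative (\<lambda>h. p x \<bullet> h)) (at x within smooth_points ?P)"
    "(p has_derivative (\<lambda>h. H x *v h)) (at x within smooth_points ?P)" if "x \<in> smooth_points ?P" for x
    using pH(1,2)[rule_format, OF subsetD[OF sm that]] sm by (blast intro: has_derivative_subset)+
  moreover have "continuous_on (smooth_points ?P) H" using pH(3) sm continuous_on_subset by blast
  ultimately show ?thesis
    unfolding solves_def cf using pH(4,5) reg refl
    by (intro conjI exI[of _ p] exI[of _ H]) blast+
qed

lemma admissible_exit_time_on_patch:
  assumes elliptic: "elliptic_bvp B" and pdd: "pdd_discretisation B K"
    and v: "continuous_on (closure (region B)) v"
  shows "admissible_data ((patch_bvp B K i)\<lparr>c_coeff := \<lambda>_. 0, f_data := \<lambda>_. 1,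
           g_data := (\<lambda>x. if x \<in> closure (region B) then v x else 0),
           phi_coeff := \<lambda>_. 0, psi_data := \<lambda>_. 0\<rparr>)"
proof -
  let ?g = "\<lambda>x. if x \<in> closure (region B) then v x else 0"
  have "continuous_on (closure (region B)) ?g" using v by (simp cong: continuous_on_cong)
  then have "continuous_on (patch_absorbing B K i) ?g"
    by (rule continuous_on_subset) (rule patch_absorbing_subset[OF elliptic pdd])
  moreover have "?g \<in> borel_measurable borel"
    by (rule borel_measurable_continuous_on_if) (use v in auto)
  ultimately show ?thesis by (simp add: admissible_data_def patch_bvp_def)
qed

section \<open>The diffusion stopped at the patch time\<close>

locale pdd_problem =
  fixes B :: "'d::finite bvp" and D :: "('w, 'd) diffusion" and K :: "'n::finite discretisation"
  assumes elliptic: "elliptic_bvp B"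
    and diffusion: "\<And>x. x \<in> closure (region B) \<Longrightarrow> reflected_diffusion B D x"
    and weight: "\<And>x. x \<in> closure (region B) \<Longrightarrow> weight_process B D x (weight D)"
    and pdd: "pdd_discretisation B K"
    and well_posed: "well_posed B D K"
    and knot_not_meeting: "\<And>i. knot K i \<notin> closure (absorbing B) \<inter> closure (reflecting B)"
    and exact: "exact_interpolation B D K"
begin

abbreviation "v \<equiv> mean_exit_time B D"

abbreviation "knot_law i \<equiv> law D (knot K i)"

abbreviation "sides i \<equiv> \<Union>e\<in>UNIV. side K i e"

text \<open>The paths that are never stopped, for which this is 0, form a null set.\<close>

definition exit_time :: "'n \<Rightarrow> 'w \<Rightarrow> real" where "exit_time i \<omega> = enn2real (patch_time B D K i \<omega>)"

definition exit_point :: "'n \<Rightarrow> 'w \<Rightarrow> point" where "exit_point i \<omega> = pos D (exit_time i \<omega>) \<omega>"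

definition exit_weight :: "'n \<Rightarrow> 'w \<Rightarrow> real" where "exit_weight i \<omega> = weight D (exit_time i \<omega>) \<omega>"

lemmas knot_in = knot_in_closure[OF elliptic pdd]

lemma prob_space_law: "prob_space (knot_law i)"
  using diffusion[OF knot_in] by (simp add: reflected_diffusion_def)

lemma adapted_imp_measurable:
  assumes "adapted_continuous (knot_law i) (hist D) X" "0 \<le> t"
  shows "X t \<in> borel_measurable (knot_law i)"
proof -
  have "filtration (space (knot_law i)) (hist D)" "sets (hist D t) \<subseteq> sets (knot_law i)"
    using diffusion[OF knot_in[of i]] by (auto simp: reflected_diffusion_def)
  then have "subalgebra (knot_law i) (hist D t)"
    by (simp add: subalgebra_def filtration.space_F)
  then show ?thesis
    by (rule measurable_from_subalg) (use assms in \<open>simp add: adapted_continuous_def\<close>)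
qed

lemma adapted_pos: "adapted_continuous (knot_law i) (hist D) (pos D)"
  using diffusion[OF knot_in[of i]] by (simp add: reflected_diffusion_def)

lemma adapted_weight: "adapted_continuous (knot_law i) (hist D) (weight D)"
  using weight[OF knot_in[of i]] by (simp add: weight_process_def)

lemma exit_time_nonneg [simp]: "0 \<le> exit_time i \<omega>" by (simp add: exit_time_def)

lemma measurable_patch_time [measurable]:
  "patch_time B D K i \<in> borel_measurable (knot_law i)"
  using well_posed by (simp add: well_posed_def)

lemma measurable_exit_time [measurable]: "exit_time i \<in> borel_measurable (knot_law i)"
  unfolding exit_time_def by measurable

lemma measurable_exit_point [measurable]: "exit_point i \<in> borel_measurable (knot_law i)"
  unfolding exit_point_def
  by (rule borel_measurable_at_random_time)
    (use adapted_imp_measurable[OF adapted_pos[of i]] adapted_pos[of i] in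
      \<open>auto simp: adapted_continuous_def\<close>)

lemma measurable_exit_weight [measurable]: "exit_weight i \<in> borel_measurable (knot_law i)"
  unfolding exit_weight_def
  by (rule borel_measurable_at_random_time)
    (use adapted_imp_measurable[OF adapted_weight[of i]] adapted_weight[of i] in
      \<open>auto simp: adapted_continuous_def\<close>)

lemma pos_in_closure: "\<omega> \<in> space (knot_law i) \<Longrightarrow> 0 \<le> t \<Longrightarrow> pos D t \<omega> \<in> closure (region B)"
  using diffusion[OF knot_in[of i]] by (simp add: reflected_diffusion_def)

lemma exit_point_in_closure: "\<omega> \<in> space (knot_law i) \<Longrightarrow> exit_point i \<omega> \<in> closure (region B)"
  by (simp add: exit_point_def pos_in_closure)

lemma AE_start: "AE \<omega> in knot_law i. pos D 0 \<omega> = knot K i"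
  using diffusion[OF knot_in[of i]] by (simp add: reflected_diffusion_def)

lemma patch_time_le: "patch_time B D K i \<omega> \<le> hitting_time D (absorbing B) \<omega>"
  unfolding patch_time_def by (rule hitting_time_antimono) (auto simp: patch_absorbing_def)

lemma nn_integral_patch_time_finite: "(\<integral>\<^sup>+ \<omega>. patch_time B D K i \<omega> \<partial>knot_law i) < \<infinity>"
proof -
  have "(\<integral>\<^sup>+ \<omega>. patch_time B D K i \<omega> \<partial>knot_law i)
      \<le> (\<integral>\<^sup>+ \<omega>. hitting_time D (absorbing B) \<omega> \<partial>knot_law i)"
    by (intro nn_integral_mono patch_time_le)
  also have "\<dots> < \<infinity>" using well_posed knot_in[of i] by (simp add: well_posed_def)
  finally show ?thesis .
qed

lemma AE_ennreal_exit_time: "AE \<omega> in knot_law i. ennreal (exit_time i \<omega>) = patch_time B D K i \<omega>"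
proof -
  have "AE \<omega> in knot_law i. patch_time B D K i \<omega> \<noteq> \<infinity>"
    by (rule nn_integral_PInf_AE) (use nn_integral_patch_time_finite[of i] in auto)
  then show ?thesis by eventually_elim (simp add: exit_time_def less_top)
qed

lemma nn_integral_exit_time: "(\<integral>\<^sup>+ \<omega>. ennreal (exit_time i \<omega>) \<partial>knot_law i) =
    (\<integral>\<^sup>+ \<omega>. patch_time B D K i \<omega> \<partial>knot_law i)"
  by (rule nn_integral_cong_AE) (rule AE_ennreal_exit_time)

lemma integrable_exit_time: "integrable (knot_law i) (exit_time i)"
  by (rule integrableI_nonneg)
    (use nn_integral_patch_time_finite[of i] in \<open>auto simp: nn_integral_exit_time\<close>)

lemma integral_exit_time: "(LINT \<omega>|knot_law i. exit_time i \<omega>) = mean_patch_time B D K i"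
  by (subst integral_eq_nn_integral) (auto simp: nn_integral_exit_time mean_patch_time_def)

lemma mean_exit_time_solves: "solves (exit_time_bvp B) v"
  using well_posed by (simp add: well_posed_def)

lemma continuous_v: "continuous_on (closure (region B)) v"
  using mean_exit_time_solves by (simp add: solves_def exit_time_bvp_def)

lemma v_nonneg: "0 \<le> v x" by (simp add: mean_exit_time_def)

lemma v_absorbing: "x \<in> absorbing B \<Longrightarrow> v x = 0"
proof -
  assume x: "x \<in> absorbing B"
  then have "x \<in> closure (region B)" using boundary_split[OF elliptic] by (auto simp: frontier_def)
  then show ?thesis using x mean_exit_time_solves by (auto simp: solves_def exit_time_bvp_def)
qed

lemma compact_closure: "compact (closure (region B))"
  using elliptic by (simp add: elliptic_bvp_def)

lemma v_bounded: obtains V where "\<And>x. x \<in> closure (region B) \<Longrightarrow> v x \<le> V"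
proof -
  have "bounded (v ` closure (region B))"
    using compact_continuous_image[OF continuous_v compact_closure] by (rule compact_imp_bounded)
  then obtain V where "\<forall>y\<in>v ` closure (region B). norm y \<le> V" by (auto simp: bounded_iff)
  then have "v x \<le> V" if "x \<in> closure (region B)" for x using that by force
  then show ?thesis by (rule that)
qed

text \<open>Feynman-Kac boundary data have to be Borel functions on the whole plane.\<close>

definition v0 :: "point \<Rightarrow> real" where "v0 x = (if x \<in> closure (region B) then v x else 0)"

lemma measurable_v0 [measurable]: "v0 \<in> borel_measurable borel"
  unfolding v0_def by (rule borel_measurable_continuous_on_if) (use continuous_v in auto)

context
  fixes i assumes na: "knot K i \<notin> absorbing B"
begin

lemma AE_patch_time_pos: "AE \<omega> in knot_law i. 0 < patch_time B D K i \<omega>"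
  using AE_start[of i] AE_space
proof eventually_elim
  case (elim \<omega>)
  then show ?case unfolding patch_time_def
    using adapted_pos[of i] knot_not_in_closure_patch_absorbing[OF elliptic pdd na knot_not_meeting]
    by (intro hitting_time_pos) (auto simp: adapted_continuous_def)
qed

text \<open>
  The quotient in the theorem is meaningful because the patch time is almost surely positive: the
  diffusion starts away from everything that stops it.
\<close>

lemma mean_patch_time_pos: "0 < mean_patch_time B D K i"
proof -
  interpret prob_space "knot_law i" by (rule prob_space_law)
  have "(\<integral>\<^sup>+ \<omega>. patch_time B D K i \<omega> \<partial>knot_law i) \<noteq> 0"
  proof
    assume "(\<integral>\<^sup>+ \<omega>. patch_time B D K i \<omega> \<partial>knot_law i) = 0"
    then have "AE \<omega> in knot_law i. patch_time B D K i \<omega> = 0"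
      by (simp add: nn_integral_0_iff_AE)
    then have "AE \<omega> in knot_law i. False"
      using AE_patch_time_pos by eventually_elim simp
    then show False by simp
  qed
  then show ?thesis using nn_integral_patch_time_finite[of i]
    by (simp add: mean_patch_time_def enn2real_positive_iff zero_less_iff_neq_zero)
qed

lemma AE_exit_weight_bounds: "AE \<omega> in knot_law i. 0 \<le> exit_weight i \<omega> \<and> exit_weight i \<omega> \<le> 1"
proof -
  have 1: "AE \<omega> in knot_law i. AE t in d_xi D \<omega>.
        0 \<le> t \<and> ennreal t < hitting_time D (absorbing B) \<omega> \<longrightarrow> pos D t \<omega> \<in> reflecting B"
    using diffusion[OF knot_in[of i]] by (simp add: reflected_diffusion_def)
  have 2: "AE \<omega> in knot_law i. \<forall>t\<ge>0. ennreal t \<le> hitting_time D (absorbing B) \<omega> \<longrightarrow>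
        set_integrable lborel {0..t} (\<lambda>s. c_coeff B (pos D s \<omega>) * weight D s \<omega>) \<and>
        set_integrable (d_xi D \<omega>) {0..t} (\<lambda>s. phi_coeff B (pos D s \<omega>) * weight D s \<omega>) \<and>
        weight D t \<omega> = 1 + (LINT s:{0..t}|lborel. c_coeff B (pos D s \<omega>) * weight D s \<omega>)
                  + (LINT s:{0..t}|d_xi D \<omega>. phi_coeff B (pos D s \<omega>) * weight D s \<omega>)"
    using weight[OF knot_in[of i]] by (simp add: weight_process_def)
  have c: "c_coeff B x \<le> 0" if "x \<in> closure (region B)" for x
    using elliptic that by (simp add: elliptic_bvp_def admissible_data_def)
  have phi: "phi_coeff B x \<le> 0" if "x \<in> reflecting B" for x
    using elliptic that closure_subset[of "reflecting B"]
    by (auto simp: elliptic_bvp_def admissible_data_def)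
  show ?thesis using 1 2 AE_patch_time_pos AE_ennreal_exit_time[of i] AE_space
  proof eventually_elim
    case (elim \<omega>)
    show ?case unfolding exit_weight_def
    proof (rule weight_nonneg_le_1[where y = "\<lambda>t. weight D t \<omega>" and t = "exit_time i \<omega>"
          and \<mu> = "d_xi D \<omega>" and \<tau> = "hitting_time D (absorbing B) \<omega>"
          and c = "\<lambda>t. c_coeff B (pos D t \<omega>)" and p = "\<lambda>t. phi_coeff B (pos D t \<omega>)"])
      show "sets (d_xi D \<omega>) = sets borel" by (simp add: d_xi_def)
      show "continuous_on {0..} (\<lambda>t. weight D t \<omega>)"
        using adapted_weight[of i] elim(5) by (simp add: adapted_continuous_def)
      show "0 < hitting_time D (absorbing B) \<omega>"
        using elim(3) patch_time_le by (rule less_le_trans)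
      show "c_coeff B (pos D t \<omega>) \<le> 0" if "0 \<le> t" for t
        using c pos_in_closure[OF elim(5) that] by simp
      show "AE t in d_xi D \<omega>. 0 \<le> t \<and> ennreal t < hitting_time D (absorbing B) \<omega> \<longrightarrow>
          phi_coeff B (pos D t \<omega>) \<le> 0"
        using elim(1) by eventually_elim (use phi in auto)
      show "ennreal (exit_time i \<omega>) \<le> hitting_time D (absorbing B) \<omega>"
        using elim(4) patch_time_le by simp
    qed (use elim(2) in auto)
  qed
qed

lemma weighted_integrable:
  fixes h :: "point \<Rightarrow> real"
  assumes [measurable]: "h \<in> borel_measurable borel"
    and "\<And>x. x \<in> closure (region B) \<Longrightarrow> \<bar>h x\<bar> \<le> C"
  shows "integrable (knot_law i) (\<lambda>\<omega>. h (exit_point i \<omega>))"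
    and "integrable (knot_law i) (\<lambda>\<omega>. exit_weight i \<omega> * h (exit_point i \<omega>))"
proof -
  interpret prob_space "knot_law i" by (rule prob_space_law)
  show 1: "integrable (knot_law i) (\<lambda>\<omega>. h (exit_point i \<omega>))"
    by (rule integrable_const_bound[of _ C]) (auto intro!: AE_I2 assms(2) exit_point_in_closure)
  show "integrable (knot_law i) (\<lambda>\<omega>. exit_weight i \<omega> * h (exit_point i \<omega>))"
  proof (rule Bochner_Integration.integrable_bound[OF 1])
    show "AE \<omega> in knot_law i. norm (exit_weight i \<omega> * h (exit_point i \<omega>)) \<le> norm (h (exit_point i \<omega>))"
      using AE_exit_weight_bounds by eventually_elim (simp add: abs_mult mult_left_le_one_le)
  qed measurable
qed

section \<open>The action of the matrix on the exit times\<close>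

text \<open>
  The strong Markov property in disguise: the expected time to absorption is the expected time to leave
  the patch plus the expected remaining time from the exit point.  It is the Feynman-Kac formula on the
  patch for the localised exit-time problem, with the constant weight 1.
\<close>

lemma mean_exit_time_splits:
  "v (knot K i) = mean_patch_time B D K i + (LINT \<omega>|knot_law i. v0 (exit_point i \<omega>))"
proof -
  let ?P = "(patch_bvp B K i)\<lparr>c_coeff := \<lambda>_. 0, f_data := \<lambda>_. 1, g_data := v0,
           phi_coeff := \<lambda>_. 0, psi_data := \<lambda>_. 0\<rparr>"
  obtain V where V: "\<And>x. x \<in> closure (region B) \<Longrightarrow> v x \<le> V" by (rule v_bounded) blast
  have "solves ?P v"
    by (rule solves_exit_time_on_patch[OF mean_exit_time_solves]) (simp add: v0_def)
  moreover have "admissible_data ?P"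
    using admissible_exit_time_on_patch[OF elliptic pdd continuous_v] by (simp add: v0_def[abs_def])
  moreover have "knot K i \<in> smooth_points ?P"
    using knot_smooth_point[OF elliptic pdd na knot_not_meeting] by (simp add: smooth_points_def)
  moreover have "weight_process ?P D (knot K i) (\<lambda>_ _. 1)"
    by (auto simp: weight_process_def adapted_continuous_def set_integrable_def
        set_lebesgue_integral_def)
  ultimately have "feynman_kac_formula ?P D (\<lambda>_ _. 1) v (knot K i)"
    using well_posed unfolding well_posed_def feynman_kac_valid_def Let_def by blast
  then have "v (knot K i) = (LINT \<omega>|knot_law i. v0 (exit_point i \<omega>) + (LINT t:{0..exit_time i \<omega>}|lborel. 1))"
    by (simp add: feynman_kac_formula_def Let_def exit_time_def exit_point_def patch_time_def patch_bvp_def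
        set_lebesgue_integral_def)
  also have "\<dots> = (LINT \<omega>|knot_law i. v0 (exit_point i \<omega>) + exit_time i \<omega>)"
    by (simp add: set_integral_const)
  also have "\<dots> = (LINT \<omega>|knot_law i. v0 (exit_point i \<omega>)) + mean_patch_time B D K i"
    unfolding integral_exit_time[symmetric]
    by (rule Bochner_Integration.integral_add[OF weighted_integrable(1)[of _ V] integrable_exit_time])
      (use V v_nonneg in \<open>simp_all add: measurable_v0, simp add: v0_def\<close>)
  finally show ?thesis by simp
qed

text \<open>
  The cardinal functions are only known to be continuous on the closure of a side; this is compact, so
  they are bounded there, and cutting them off with the indicator of the side makes them measurable.
\<close>

lemma integrable_cardinal:
  assumes "j \<in> stencil K i e"
  shows "integrable (knot_law i)
    (\<lambda>\<omega>. exit_weight i \<omega> * (indicator (side K i e) (exit_point i \<omega>) * cardinal_fn K i e j (exit_point i \<omega>)))"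
proof -
  let ?H = "cardinal_fn K i e j" and ?S = "side K i e"
  have cont: "continuous_on (closure ?S) ?H" and S: "?S \<in> sets borel"
    using pdd assms by (auto simp: pdd_discretisation_def)
  have "?S \<subseteq> closure (region B)"
    using patch_absorbing_subset[OF elliptic pdd, of i] by (auto simp: patch_absorbing_def)
  then have "bounded ?S" using compact_closure compact_imp_bounded bounded_subset by blast
  then have "compact (closure ?S)" by simp
  then have "bounded (?H ` closure ?S)" using cont compact_continuous_image compact_imp_bounded by blast
  then obtain C where C: "\<forall>y\<in>?H ` closure ?S. norm y \<le> C" by (auto simp: bounded_iff)
  have "\<bar>indicator ?S x * ?H x\<bar> \<le> max 0 C" for x
    using C closure_subset[of ?S] by (auto simp: indicator_def le_max_iff_disj)
  moreover have "(\<lambda>x. indicator ?S x * ?H x) \<in> borel_measurable borel"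
  proof -
    have "(\<lambda>x. if x \<in> ?S then ?H x else 0) \<in> borel_measurable borel"
      by (rule borel_measurable_continuous_on_if)
        (use S continuous_on_subset[OF cont closure_subset] in auto)
    then show ?thesis by (rule measurable_cong[THEN iffD1, rotated]) (simp add: indicator_def)
  qed
  ultimately show ?thesis by (intro weighted_integrable(2)[where h = "\<lambda>x. indicator ?S x * ?H x"]) auto
qed

text \<open>
  Where exact interpolation enters.  Since the sides are disjoint, at most one of them contributes.
\<close>

lemma sum_over_sides:
  fixes u :: "point \<Rightarrow> real"
  assumes "u = (\<lambda>x. \<alpha> + \<beta> * v x)"
  shows "(\<Sum>e\<in>UNIV. \<Sum>j\<in>stencil K i e. u (knot K j) *
            (indicator (side K i e) z * cardinal_fn K i e j z))
       = indicator (sides i) z * u z"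
proof -
  have "(\<Sum>j\<in>stencil K i e. u (knot K j) * (indicator (side K i e) z * cardinal_fn K i e j z))
      = indicator (side K i e) z * u z" for e
    using exact assms by (auto simp: exact_interpolation_def Let_def indicator_def)
  moreover have "disjoint_family (side K i)"
    using pdd by (auto simp: pdd_discretisation_def disjoint_family_on_def)
  then have "(\<Sum>e\<in>UNIV. indicator (side K i e) z) = (indicator (sides i) z :: real)"
    by (subst indicator_UN_disjoint) auto
  ultimately show ?thesis by (simp add: sum_distrib_right[symmetric])
qed

text \<open>
  On functions that are interpolated exactly, a row of the matrix acts as \<open>u\<close> at the knot minus the
  discounted expectation of \<open>u\<close> at the exit through the sides: a discrete version of the operator.
\<close>

lemma matrix_row:
  fixes u :: "point \<Rightarrow> real"
  assumes u: "u = (\<lambda>x. \<alpha> + \<beta> * v x)"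
  shows "(pdd_matrix B D K *v (\<chi> j. u (knot K j))) $ i = u (knot K i) -
     (LINT \<omega>|knot_law i. exit_weight i \<omega> * (indicator (sides i) (exit_point i \<omega>) * u (exit_point i \<omega>)))"
proof -
  let ?I = "\<lambda>e j. LINT \<omega>|knot_law i.
      exit_weight i \<omega> * (indicator (side K i e) (exit_point i \<omega>) * cardinal_fn K i e j (exit_point i \<omega>))"
  have no_self: "i \<notin> stencil K i e" for e using pdd by (simp add: pdd_discretisation_def)
  have entry: "pdd_matrix B D K $ i $ j = (if i = j then 1 else 0) -
      (\<Sum>e\<in>{e. j \<in> stencil K i e}. ?I e j)" for j
    using na no_self
    by (cases "i = j") (simp_all add: pdd_matrix_def Let_def exit_time_def exit_weight_def exit_point_def mult.assoc)
  have "(pdd_matrix B D K *v (\<chi> j. u (knot K j))) $ i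
      = u (knot K i) - (\<Sum>j\<in>UNIV. \<Sum>e\<in>{e. j \<in> stencil K i e}. ?I e j * u (knot K j))"
    by (simp add: matrix_vector_mult_def entry left_diff_distrib sum_subtractf sum_distrib_right
        if_distrib[of "\<lambda>c. c * _"] cong: if_cong)
  also have "(\<Sum>j\<in>UNIV. \<Sum>e\<in>{e. j \<in> stencil K i e}. ?I e j * u (knot K j))
      = (\<Sum>e\<in>UNIV. \<Sum>j\<in>stencil K i e. ?I e j * u (knot K j))"
    using sum.swap_restrict[of UNIV UNIV "\<lambda>j e. ?I e j * u (knot K j)" "\<lambda>j e. j \<in> stencil K i e"]
    by simp
  also have "\<dots> = (LINT \<omega>|knot_law i. (\<Sum>e\<in>UNIV. \<Sum>j\<in>stencil K i e. exit_weight i \<omega> *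
      (indicator (side K i e) (exit_point i \<omega>) * cardinal_fn K i e j (exit_point i \<omega>)) * u (knot K j)))"
    using integrable_cardinal by (simp add: Bochner_Integration.integral_sum)
  also have "\<dots> = (LINT \<omega>|knot_law i. exit_weight i \<omega> * (\<Sum>e\<in>UNIV. \<Sum>j\<in>stencil K i e. u (knot K j) *
      (indicator (side K i e) (exit_point i \<omega>) * cardinal_fn K i e j (exit_point i \<omega>))))"
    by (simp add: sum_distrib_left mult_ac)
  finally show ?thesis unfolding sum_over_sides[OF u] .
qed

text \<open>
  A row sum is 1 minus the discounted probability of leaving through a side.
\<close>

lemma matrix_row_one: "0 \<le> (pdd_matrix B D K *v 1) $ i"
proof -
  interpret prob_space "knot_law i" by (rule prob_space_law)
  have S: "sides i \<in> sets borel"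
    using pdd by (auto simp: pdd_discretisation_def)
  have "(LINT \<omega>|knot_law i. exit_weight i \<omega> * (indicator (sides i) (exit_point i \<omega>) * 1)) \<le>
     (LINT \<omega>|knot_law i. 1)"
  proof (rule integral_mono_AE)
    show "integrable (knot_law i) (\<lambda>\<omega>. exit_weight i \<omega> * (indicator (sides i) (exit_point i \<omega>) * 1))"
      using weighted_integrable(2)[of "indicator (sides i)" 1] S by simp
    show "AE \<omega> in knot_law i. exit_weight i \<omega> * (indicator (sides i) (exit_point i \<omega>) * 1) \<le> 1"
      using AE_exit_weight_bounds by eventually_elim (simp add: indicator_def)
  qed simp
  then show ?thesis
    using matrix_row[of "\<lambda>_. 1" 1 0] prob_space by (simp add: one_vec_def)
qed

text \<open>
  Dropping the discount and the restriction to the sides only increases the subtracted expectation,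
  as \<open>v \<ge> 0\<close>; what remains of \<open>v\<close> at the knot is the expected patch time.
\<close>

lemma matrix_row_exit_time:
  "mean_patch_time B D K i \<le> (pdd_matrix B D K *v (\<chi> j. v (knot K j))) $ i"
proof -
  obtain V where V: "\<And>x. x \<in> closure (region B) \<Longrightarrow> v x \<le> V" by (rule v_bounded) blast
  have S: "sides i \<in> sets borel"
    using pdd by (auto simp: pdd_discretisation_def)
  have eq: "(LINT \<omega>|knot_law i. exit_weight i \<omega> * (indicator (sides i) (exit_point i \<omega>) * v (exit_point i \<omega>)))
      = (LINT \<omega>|knot_law i. exit_weight i \<omega> * (indicator (sides i) (exit_point i \<omega>) * v0 (exit_point i \<omega>)))"
    by (rule Bochner_Integration.integral_cong) (auto simp: v0_def exit_point_in_closure)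
  have "\<dots> \<le> (LINT \<omega>|knot_law i. v0 (exit_point i \<omega>))"
  proof (rule integral_mono_AE)
    have b: "\<bar>v0 x\<bar> \<le> V" "\<bar>indicator (sides i) x * v0 x\<bar> \<le> V"
      if "x \<in> closure (region B)" for x
      using V[OF that] v_nonneg[of x] by (auto simp: v0_def indicator_def)
    show "integrable (knot_law i) (\<lambda>\<omega>. v0 (exit_point i \<omega>))"
      by (rule weighted_integrable(1)[OF _ b(1)]) auto
    show "integrable (knot_law i) (\<lambda>\<omega>. exit_weight i \<omega> * (indicator (sides i) (exit_point i \<omega>) * v0 (exit_point i \<omega>)))"
      by (rule weighted_integrable(2)[OF _ b(2)]) (use S in auto)
    show "AE \<omega> in knot_law i. exit_weight i \<omega> * (indicator (sides i) (exit_point i \<omega>) * v0 (exit_point i \<omega>)) \<le> v0 (exit_point i \<omega>)"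
      using AE_exit_weight_bounds
    proof eventually_elim
      case (elim \<omega>)
      have "0 \<le> v0 (exit_point i \<omega>)" by (simp add: v0_def v_nonneg)
      then show ?case using elim by (simp add: indicator_def mult_left_le_one_le)
    qed
  qed
  then show ?thesis
    using matrix_row[of v 0 1] mean_exit_time_splits eq by simp
qed

end

section \<open>Barriers and the norm bound\<close>

lemma matrix_row_absorbing:
  "knot K i \<in> absorbing B \<Longrightarrow> (pdd_matrix B D K *v x) $ i = x $ i"
  by (simp add: matrix_vector_mult_def pdd_matrix_def if_distrib[of "\<lambda>c. c * _"] cong: if_cong)

lemma knot_cases:
  obtains "knot K i \<in> region B" "knot K i \<notin> absorbing B"
    | "knot K i \<in> reflecting B" "knot K i \<notin> region B" "knot K i \<notin> absorbing B"
    | "knot K i \<in> absorbing B" "knot K i \<notin> region B"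
proof -
  have "region B \<inter> frontier (region B) = {}"
    using open_region[OF elliptic] by (auto simp: frontier_def interior_open)
  moreover have "closure (region B) = region B \<union> frontier (region B)"
    using closure_Un_frontier by blast
  ultimately show ?thesis using knot_in[of i] boundary_split[OF elliptic] boundary_disjoint[OF elliptic] that
    by blast
qed

text \<open>
  The barrier is \<open>1 + v / m\<close>: the constant takes care of the absorbing rows, where \<open>v\<close> vanishes, and
  \<open>v / m\<close> of the others.
\<close>

lemma exit_time_barrier:
  assumes off: "\<And>i j. i \<noteq> j \<Longrightarrow> pdd_matrix B D K $ i $ j \<le> 0"
    and m: "0 < m" "\<And>i. knot K i \<notin> absorbing B \<Longrightarrow> m \<le> mean_patch_time B D K i"
    and M: "\<And>i. v (knot K i) \<le> M"
  shows "matrix_infnorm (matrix_inv (pdd_matrix B D K)) \<le> 1 + M / m"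
proof -
  let ?G = "pdd_matrix B D K" and ?V = "\<chi> j. v (knot K j)"
  define w where "w = 1 + (1 / m) *\<^sub>R ?V"
  have w: "w $ i = 1 + v (knot K i) / m" for i by (simp add: w_def)
  show ?thesis
  proof (rule matrix_infnorm_inverse_le[OF off])
    show "0 \<le> w $ i" for i using m(1) v_nonneg[of "knot K i"] by (simp add: w)
    show "w $ i \<le> 1 + M / m" for i using m(1) M by (simp add: w divide_right_mono)
    show "1 \<le> (?G *v w) $ i" for i
    proof (cases "knot K i \<in> absorbing B")
      case True
      then show ?thesis by (simp add: matrix_row_absorbing w v_absorbing)
    next
      case False
      have "(?G *v w) $ i = (?G *v 1) $ i + (?G *v ?V) $ i / m"
        by (simp add: w_def matrix_vector_right_distrib matrix_vector_mult_scaleR)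
      moreover have "1 \<le> (?G *v ?V) $ i / m"
        using m(1) m(2)[OF False] matrix_row_exit_time[OF False] by simp
      ultimately show ?thesis using matrix_row_one[OF False] by linarith
    qed
  qed
qed

text \<open>
  A row only sees the values at its own knot and at its stencils, so different barriers can be glued.
\<close>

lemma matrix_row_cong:
  assumes "knot K i \<notin> absorbing B" "x $ i = y $ i"
    and "\<And>e j. j \<in> stencil K i e \<Longrightarrow> x $ j = y $ j"
  shows "(pdd_matrix B D K *v x) $ i = (pdd_matrix B D K *v y) $ i"
proof -
  have "pdd_matrix B D K $ i $ j * x $ j = pdd_matrix B D K $ i $ j * y $ j" for j
  proof (cases "i = j \<or> (\<exists>e. j \<in> stencil K i e)")
    case True
    then show ?thesis using assms(2,3) by auto
  next
    case False
    then have "pdd_matrix B D K $ i $ j = 0" using assms(1) by (simp add: pdd_matrix_def)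
    then show ?thesis by simp
  qed
  then show ?thesis by (simp only: matrix_vector_mult_def vec_lambda_beta)
qed

text \<open>
  If no stencil contains a boundary knot, the rows of the interior knots form a closed system, for
  which \<open>v / m\<close> alone is a barrier, bounded by \<open>M / m\<close>.  The knots on the boundary then add a single
  step, which costs the summand 1: a reflecting row takes a sum of interior values with nonnegative
  weights of total at most 1.
\<close>

lemma interior_stencil_barrier:
  assumes off: "\<And>i j. i \<noteq> j \<Longrightarrow> pdd_matrix B D K $ i $ j \<le> 0"
    and m: "0 < m" "\<And>i. knot K i \<notin> absorbing B \<Longrightarrow> m \<le> mean_patch_time B D K i"
    and M: "0 \<le> M" "\<And>i. knot K i \<in> region B \<Longrightarrow> v (knot K i) \<le> M"
    and stencil: "\<And>i e j. j \<in> stencil K i e \<Longrightarrow> knot K j \<in> region B"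
  shows "matrix_infnorm (matrix_inv (pdd_matrix B D K)) \<le> 1 + M / m"
proof -
  let ?G = "pdd_matrix B D K" and ?V = "\<chi> j. v (knot K j)"
  define w where "w = (\<chi> i. if knot K i \<in> region B then v (knot K i) / m else 1 + M / m)"
  have le: "v (knot K i) / m \<le> M / m" if "knot K i \<in> region B" for i
    using m(1) M(2)[OF that] by (simp add: divide_right_mono)
  show ?thesis
  proof (rule matrix_infnorm_inverse_le[OF off])
    show "0 \<le> w $ i" for i using m(1) M(1) v_nonneg[of "knot K i"] by (simp add: w_def)
    show "w $ i \<le> 1 + M / m" for i using le[of i] by (auto simp: w_def)
    show "1 \<le> (?G *v w) $ i" for i
    proof (rule knot_cases[of i])
      assume i: "knot K i \<in> region B" "knot K i \<notin> absorbing B"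
      have "(?G *v w) $ i = (?G *v ((1 / m) *\<^sub>R ?V)) $ i"
        by (rule matrix_row_cong) (use i stencil in \<open>auto simp: w_def\<close>)
      also have "\<dots> = (?G *v ?V) $ i / m" by (simp add: matrix_vector_mult_scaleR)
      also have "1 \<le> \<dots>" using m(1) m(2)[OF i(2)] matrix_row_exit_time[OF i(2)] by simp
      finally show ?thesis .
    next
      assume i: "knot K i \<in> reflecting B" "knot K i \<notin> region B" "knot K i \<notin> absorbing B"
      have row: "(?G *v y) $ i = y $ i + (\<Sum>j\<in>UNIV - {i}. ?G $ i $ j * y $ j)" for y
        by (simp add: matrix_vector_mult_def sum.remove[of UNIV i] pdd_matrix_def)
      \<comment> \<open>Raising all interior values to \<open>M / m\<close> gives a multiple of a row sum, which is nonnegative.\<close>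
      have "1 \<le> 1 + (M / m) * (?G *v 1) $ i" using matrix_row_one[OF i(3)] m(1) M(1) by simp
      also have "\<dots> = 1 + M / m + (\<Sum>j\<in>UNIV - {i}. ?G $ i $ j * (M / m))"
        by (simp add: row distrib_left sum_distrib_left sum_divide_distrib mult_ac)
      also have "\<dots> \<le> w $ i + (\<Sum>j\<in>UNIV - {i}. ?G $ i $ j * w $ j)"
      proof (intro add_mono sum_mono)
        show "1 + M / m \<le> w $ i" using i(2) by (simp add: w_def)
        fix j assume j: "j \<in> UNIV - {i}"
        show "?G $ i $ j * (M / m) \<le> ?G $ i $ j * w $ j"
        proof (cases "\<exists>e. j \<in> stencil K i e")
          case True
          then have "knot K j \<in> region B" using stencil by blast
          then show ?thesis using le[of j] off[of i j] j
            by (intro mult_left_mono_neg) (auto simp: w_def)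
        next
          case False
          then have "?G $ i $ j = 0" using i(3) j by (simp add: pdd_matrix_def)
          then show ?thesis by simp
        qed
      qed
      also have "\<dots> = (?G *v w) $ i" by (simp add: row)
      finally show ?thesis .
    next
      assume "knot K i \<in> absorbing B" "knot K i \<notin> region B"
      then show ?thesis using m(1) M(1) by (simp add: matrix_row_absorbing w_def)
    qed
  qed
qed

end

theorem theorem10:
  fixes B :: "'d::finite bvp"
    and D :: "('w, 'd) diffusion"
    and K :: "'n::finite discretisation"
  assumes "elliptic_bvp B"
    and "\<And>x. x \<in> closure (region B) \<Longrightarrow> reflected_diffusion B D x"
    and "\<And>x. x \<in> closure (region B) \<Longrightarrow> weight_process B D x (weight D)"
    and "pdd_discretisation B K"
    and "well_posed B D K"
    and "\<And>i. knot K i \<notin> closure (absorbing B) \<inter> closure (reflecting B)"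
    and "invertible_M_matrix (pdd_matrix B D K)"
    and "exact_interpolation B D K"
    and "\<exists>i. knot K i \<in> region B"
  shows "matrix_infnorm (matrix_inv (pdd_matrix B D K))
           \<le> 1 + (MAX i\<in>{i. knot K i \<in> closure (region B) - absorbing B}. mean_exit_time B D (knot K i))
                / (MIN j\<in>{j. knot K j \<in> closure (region B) - absorbing B}. mean_patch_time B D K j)
         \<and>
         ((\<forall>i. knot K i \<in> reflecting B \<longrightarrow>
              (\<exists>j. knot K j \<in> region B \<and>
                   mean_exit_time B D (knot K i) \<le> mean_exit_time B D (knot K j))) \<or>
          (\<forall>i e. \<forall>j\<in>stencil K i e. knot K j \<in> region B)
          \<longrightarrow>
          matrix_infnorm (matrix_inv (pdd_matrix B D K))
            \<le> 1 + (MAX i\<in>{i. knot K i \<in> region B}. mean_exit_time B D (knot K i))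
                 / (MIN j\<in>{j. knot K j \<in> closure (region B) - absorbing B}. mean_patch_time B D K j))"
proof -
  interpret pdd_problem B D K by (rule pdd_problem.intro[OF assms(1-6,8)])
  let ?N = "{i. knot K i \<in> closure (region B) - absorbing B}" and ?R = "{i. knot K i \<in> region B}"
  let ?M = "MAX i\<in>?N. v (knot K i)" and ?M' = "MAX i\<in>?R. v (knot K i)"
  let ?m = "MIN j\<in>?N. mean_patch_time B D K j"
  obtain r where r: "knot K r \<in> region B" using assms(9) by blast
  then have rN: "r \<in> ?N" using knot_in knot_cases[of r] by auto
  obtain A where "pdd_matrix B D K = mat 1 - A" "\<And>i j. 0 \<le> A $ i $ j"
    using assms(7) by (auto simp: invertible_M_matrix_def)
  then have off: "pdd_matrix B D K $ i $ j \<le> 0" if "i \<noteq> j" for i j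
    using that by (simp add: mat_def)
  have "?m \<in> mean_patch_time B D K ` ?N" by (rule Min_in) (use rN in auto)
  then have m_pos: "0 < ?m" using mean_patch_time_pos by auto
  have m_le: "?m \<le> mean_patch_time B D K i" if "knot K i \<notin> absorbing B" for i
    by (rule Min_le) (use that knot_in in auto)
  have M_ge: "v (knot K i) \<le> ?M" if "knot K i \<notin> absorbing B" for i
    by (rule Max_ge) (use that knot_in in auto)
  have M'_ge: "v (knot K i) \<le> ?M'" if "knot K i \<in> region B" for i
    by (rule Max_ge) (use that in auto)
  have M_nonneg: "0 \<le> ?M" "0 \<le> ?M'"
    using order_trans[OF v_nonneg M_ge[of r]] order_trans[OF v_nonneg M'_ge[OF r]] rN by auto
  have v_le: "v (knot K i) \<le> ?M" for i
    using M_ge[of i] M_nonneg(1) v_absorbing[of "knot K i"] by (cases "knot K i \<in> absorbing B") auto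
  have 1: "matrix_infnorm (matrix_inv (pdd_matrix B D K)) \<le> 1 + ?M / ?m"
    by (rule exit_time_barrier[OF off m_pos m_le v_le])
  have 2: "matrix_infnorm (matrix_inv (pdd_matrix B D K)) \<le> 1 + ?M' / ?m"
    if dominated: "\<forall>i. knot K i \<in> reflecting B \<longrightarrow>
              (\<exists>j. knot K j \<in> region B \<and> v (knot K i) \<le> v (knot K j))"
  proof (rule exit_time_barrier[OF off m_pos m_le])
    show "v (knot K i) \<le> ?M'" for i
    proof (rule knot_cases[of i])
      assume "knot K i \<in> reflecting B"
      then obtain j where j: "knot K j \<in> region B" "v (knot K i) \<le> v (knot K j)"
        using dominated by blast
      from j(2) M'_ge[OF j(1)] show ?thesis by (rule order_trans)
    qed (use M'_ge M_nonneg(2) v_absorbing in auto)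
  qed
  have 3: "matrix_infnorm (matrix_inv (pdd_matrix B D K)) \<le> 1 + ?M' / ?m"
    if "\<forall>i e. \<forall>j\<in>stencil K i e. knot K j \<in> region B"
    by (rule interior_stencil_barrier[OF off m_pos m_le M_nonneg(2) M'_ge]) (use that in auto)
  show ?thesis using 1 2 3 by blast
qed

end
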